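(* Let $f=(\mathsf{x}(f),\mathsf{y}(f),\mathsf{t}(f))$ be a $C^2$-harmonic mapping on a domain $\Omega\subset\mathbb{R}^n$, with $\mathsf{x}(f)=H\circ\mathsf{y}(f)$, and suppose that for some constant $C$ $$\sup_\Omega\left|\frac{(H''\circ\mathsf{y}(f))(H'\circ\mathsf{y}(f))}{1+(H'\circ\mathsf{y}(f))^2}\right|<C .$$ If $\mathsf{y}(f)(x_0)=\sup_{\Omega}\mathsf{y}(f)$ at some $x_0\in\Omega$, then $\mathsf{y}(f)$ is constant in $\Omega$. In such a case, also the component functions $\mathsf{x}(f)$ and $\mathsf{t}(f)$ are constant in $\Omega$.
   Context: The first Heisenberg group $\mathbb{H}^1$ is $\mathbb{R}^3$ with coordinates $(\mathsf{x},\mathsf{y},\mathsf{t})$ and contact form $\theta=d\mathsf{t}+2(\mathsf{x}\,d\mathsf{y}-\mathsf{y}\,d\mathsf{x})$. Let $\Omega\subset\mathbb{R}^n$ be a domain. A harmonic curve (also called $C^2$-harmonic mapping) is a $C^2$ map $f=(\mathsf{x},\mathsf{y},\mathsf{t}):\Omega\to\mathbb{H}^1$ (components also written $\mathsf{x}(f),\mathsf{y}(f),\mathsf{t}(f)$), also written $f=(\mathsf{z},\mathsf{t})$ with $\mathsf{z}=\mathsf{x}+i\mathsf{y}$, such that: (1) (isotropicity) $\frac{\partial\mathsf{x}}{\partial x_\alpha}\frac{\partial\mathsf{y}}{\partial x_\beta}-\frac{\partial\mathsf{x}}{\partial x_\beta}\frac{\partial\mathsf{y}}{\partial x_\alpha}=0$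 for all $\alpha<\beta$, and the contact condition $f^*\theta=0$ holds, i.e. $\nabla\mathsf{t}=2(\mathsf{y}\nabla\mathsf{x}-\mathsf{x}\nabla\mathsf{y})$; (2) (criticality) $\mathsf{z}$ is a critical point of $E^2(f)=\int_\Omega|\nabla\mathsf{z}|^2dx$, where $|\nabla\mathsf{z}|^2=|\nabla\mathsf{x}|^2+|\nabla\mathsf{y}|^2$, with respect to domain variations $\mathsf{z}_s(x)=\mathsf{z}(x+s\xi(x))$, $\xi\in C_0^\infty(\Omega,\mathbb{R}^n)$; that is, for all $\phi\in C_0^\infty(\Omega)$ and $\gamma=1,\dots,n$, $$\int_\Omega\Big(|\nabla\mathsf{z}|^2\frac{\partial\phi}{\partial x_\gamma}-2\sum_{\beta=1}^n\Big(\frac{\partial\mathsf{x}}{\partial x_\beta}\frac{\partial\mathsf{x}}{\partial x_\gamma}+\frac{\partial\mathsf{y}}{\partial x_\beta}\frac{\partial\mathsf{y}}{\partial x_\gamma}\Big)\frac{\partial\phi}{\partial x_\beta}\Big)dx=0.$$ Throughout, $\mathsf{x}=H\circ\mathsf{y}$ for a $C^2$ function $H:I\to\mathbb{R}$ on an interval $I\supset\mathsf{y}(\Omega)$. For such maps, criticality is equivalent to $$\Delta\mathsf{y}=-\frac{(H''\circ\mathsf{y})(H'\circ\mathsf{y})}{1+(H'\circ\mathsf{y})^2}|\nabla\mathsf{y}|^2\quad\text{in }\Omega.$$ *)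

theory Defs
  imports "HOL-Analysis.Analysis"
begin

section \<open>Functions of class \<open>C\<^sup>k\<close> and test functions on \<open>\<real>\<^sup>n\<close>\<close>

definition partial_deriv ::
    "'n::finite \<Rightarrow> (real^'n \<Rightarrow> 'b::real_normed_vector) \<Rightarrow> real^'n \<Rightarrow> 'b" where
  "partial_deriv i f p = frechet_derivative f (at p) (axis i 1)"

text \<open>Intended for open \<open>S\<close>; then only the values of \<open>f\<close> on \<open>S\<close> matter.\<close>

primrec Ck_on ::
    "nat \<Rightarrow> (real^'n::finite \<Rightarrow> 'b::real_normed_vector) \<Rightarrow> (real^'n) set \<Rightarrow> bool" where
  "Ck_on 0 f S \<longleftrightarrow> continuous_on S f"
| "Ck_on (Suc k) f S \<longleftrightarrow>
     (\<forall>p\<in>S. f differentiable (at p)) \<and> (\<forall>i. Ck_on k (partial_deriv i f) S)"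

text \<open>The space \<open>C\<^sub>0\<^sup>\<infinity>(\<Omega>)\<close>, its members being extended by \<open>0\<close> to all of \<open>\<real>\<^sup>n\<close>.\<close>

definition test_function :: "(real^'n::finite) set \<Rightarrow> (real^'n \<Rightarrow> real) \<Rightarrow> bool" where
  "test_function \<Omega> \<phi> \<longleftrightarrow>
     (\<forall>k. Ck_on k \<phi> UNIV) \<and> compact (closure {p. \<phi> p \<noteq> 0}) \<and> closure {p. \<phi> p \<noteq> 0} \<subseteq> \<Omega>"

section \<open>Harmonic mappings into the first Heisenberg group\<close>

type_synonym heisenberg = "real^3"

abbreviation x_comp :: "('a \<Rightarrow> heisenberg) \<Rightarrow> 'a \<Rightarrow> real" where
  "x_comp f \<equiv> \<lambda>p. f p $ 1"

abbreviation y_comp :: "('a \<Rightarrow> heisenberg) \<Rightarrow> 'a \<Rightarrow> real" where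
  "y_comp f \<equiv> \<lambda>p. f p $ 2"

abbreviation t_comp :: "('a \<Rightarrow> heisenberg) \<Rightarrow> 'a \<Rightarrow> real" where
  "t_comp f \<equiv> \<lambda>p. f p $ 3"

text \<open>\<open>contact_form q v\<close> is \<open>\<theta> = dt + 2 (x dy - y dx)\<close> at the point \<open>q\<close>, applied to the
  tangent vector \<open>v\<close>.\<close>

definition contact_form :: "heisenberg \<Rightarrow> heisenberg \<Rightarrow> real" where
  "contact_form q v = v $ 3 + 2 * (q $ 1 * v $ 2 - q $ 2 * v $ 1)"

text \<open>The condition \<open>f\<^sup>*\<theta> = 0\<close> on \<open>\<Omega>\<close>.\<close>

definition contact_map :: "(real^'n::finite) set \<Rightarrow> (real^'n \<Rightarrow> heisenberg) \<Rightarrow> bool" where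
  "contact_map \<Omega> f \<longleftrightarrow>
     (\<forall>p\<in>\<Omega>. \<forall>v. contact_form (f p) (frechet_derivative f (at p) v) = 0)"

text \<open>The index type carries no order. As the expression below is antisymmetric in
  \<open>\<alpha>, \<beta>\<close>, quantifying over all pairs is the same as over the pairs \<open>\<alpha> < \<beta>\<close>.\<close>

definition isotropic_map :: "(real^'n::finite) set \<Rightarrow> (real^'n \<Rightarrow> heisenberg) \<Rightarrow> bool" where
  "isotropic_map \<Omega> f \<longleftrightarrow>
     (\<forall>p\<in>\<Omega>. \<forall>\<alpha> \<beta>.
        partial_deriv \<alpha> (x_comp f) p * partial_deriv \<beta> (y_comp f) p
        - partial_deriv \<beta> (x_comp f) p * partial_deriv \<alpha> (y_comp f) p = 0)"

text \<open>\<open>|\<nabla>z|\<^sup>2 = |\<nabla>x|\<^sup>2 + |\<nabla>y|\<^sup>2\<close>\<close>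

definition energy_density :: "(real^'n::finite \<Rightarrow> heisenberg) \<Rightarrow> real^'n \<Rightarrow> real" where
  "energy_density f p =
     (\<Sum>\<beta>\<in>UNIV. (partial_deriv \<beta> (x_comp f) p)\<^sup>2) + (\<Sum>\<beta>\<in>UNIV. (partial_deriv \<beta> (y_comp f) p)\<^sup>2)"

text \<open>Criticality of \<open>z = x + i y\<close> for the energy \<open>\<integral>\<^sub>\<Omega> |\<nabla>z|\<^sup>2\<close> with respect to domain
  variations \<open>z(x + s \<xi>(x))\<close>, in the form of the first variation formula (the choice
  \<open>\<xi> = \<phi> e\<^sub>\<gamma>\<close>).\<close>

definition domain_critical :: "(real^'n::finite) set \<Rightarrow> (real^'n \<Rightarrow> heisenberg) \<Rightarrow> bool" where
  "domain_critical \<Omega> f \<longleftrightarrow>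
     (\<forall>\<phi>. test_function \<Omega> \<phi> \<longrightarrow> (\<forall>\<gamma>.
        (LINT p:\<Omega>|lborel.
           energy_density f p * partial_deriv \<gamma> \<phi> p
           - 2 * (\<Sum>\<beta>\<in>UNIV.
                (partial_deriv \<beta> (x_comp f) p * partial_deriv \<gamma> (x_comp f) p
                 + partial_deriv \<beta> (y_comp f) p * partial_deriv \<gamma> (y_comp f) p)
                * partial_deriv \<beta> \<phi> p)) = 0))"

definition harmonic_mapping :: "(real^'n::finite) set \<Rightarrow> (real^'n \<Rightarrow> heisenberg) \<Rightarrow> bool" where
  "harmonic_mapping \<Omega> f \<longleftrightarrow>
     Ck_on 2 f \<Omega> \<and> isotropic_map \<Omega> f \<and> contact_map \<Omega> f \<and> domain_critical \<Omega> f"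

section \<open>Functions of class \<open>C\<^sup>2\<close> on an interval\<close>

text \<open>\<open>H\<close> is of class \<open>C\<^sup>2\<close> on the interval \<open>I\<close> with first and second derivatives
  \<open>H'\<close> and \<open>H''\<close>. The interval may be of any kind; at an end point belonging to \<open>I\<close> the
  derivatives are one-sided.\<close>

definition C2_on_interval ::
    "real set \<Rightarrow> (real \<Rightarrow> real) \<Rightarrow> (real \<Rightarrow> real) \<Rightarrow> (real \<Rightarrow> real) \<Rightarrow> bool" where
  "C2_on_interval I H H' H'' \<longleftrightarrow>
     is_interval I \<and>
     (\<forall>u\<in>I. (H has_real_derivative H' u) (at u within I)) \<and>
     (\<forall>u\<in>I. (H' has_real_derivative H'' u) (at u within I)) \<and>
     continuous_on I H''"

end

theory Submission
  imports Defs
begin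

text \<open>Writing \<open>a = 1 + (H' \<circ> y)\<^sup>2\<close>, the first variation formula says that the tensor
  \<open>a (|\<nabla>y|\<^sup>2 \<delta>\<^sub>\<beta>\<^sub>\<gamma> - 2 y\<^sub>\<beta> y\<^sub>\<gamma>)\<close> is weakly divergence free. Testing with bump functions gives the pointwise
  identity \<open>y\<^sub>\<gamma> ((H'' H') \<circ> y |\<nabla>y|\<^sup>2 + a \<Delta>y) = 0\<close>, hence \<open>\<Delta>y \<ge> - C |\<nabla>y|\<^sup>2\<close> wherever \<open>\<nabla>y \<noteq> 0\<close>.
  That is enough for Hopf's argument: if \<open>y\<close> is not constant, a ball of non-maximal points touches
  the set of maximal points at \<open>q\<close>, and \<open>y\<close> plus a small multiple of a shifted Gaussian has a
  maximum near \<open>q\<close> at a point where its Laplacian is positive. With \<open>y\<close> and \<open>x = H \<circ> y\<close> constant,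
  the contact condition gives \<open>\<nabla>t = 0\<close>.\<close>

section \<open>Partial derivatives\<close>

text \<open>Domain variations yield the equation for the Laplacian only multiplied by
  \<open>partial_deriv \<gamma> y\<close>, so nothing is known at critical points of
  \<open>y\<close>, in particular at the maximal points themselves. Hopf's method tolerates this
  because the contradiction is drawn elsewhere: where \<open>y\<close> plus
  \<open>\<epsilon>\<close> times the barrier is maximal, the gradient of \<open>y\<close> is minus
  \<open>\<epsilon>\<close> times that of the barrier, which does not vanish away from its centre.
  There the term \<open>C * |grad y|^2\<close> is of order \<open>\<epsilon>^2\<close>, whereas the
  Laplacian of the perturbation is of order \<open>\<epsilon>\<close>; so any constant
  \<open>C\<close> is absorbed by a small \<open>\<epsilon>\<close>. The regularity is just
  sufficient: \<open>H'\<close> is C^1, hence so is the tensor, and a single integration by parts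
  leads from the weak to the pointwise identity.\<close>

lemma partial_deriv_eqI:
  "(f has_derivative f') (at p) \<Longrightarrow> partial_deriv i f p = f' (axis i 1)"
  by (simp add: partial_deriv_def frechet_derivative_at [symmetric])

lemma has_derivative_partial_deriv:
  assumes "f differentiable (at p)"
  shows "(f has_derivative frechet_derivative f (at p)) (at p)"
  using assms by (simp add: frechet_derivative_works)

lemma partial_deriv_cong:
  assumes "open S" "p \<in> S" "\<And>q. q \<in> S \<Longrightarrow> f q = g q" "f differentiable (at p)"
  shows "partial_deriv i f p = partial_deriv i g p"
  unfolding partial_deriv_def using frechet_derivative_transform_within_open[OF assms(4,1,2,3)] by simp

lemma differentiable_cong_open:
  assumes "open S" "p \<in> S" "\<And>q. q \<in> S \<Longrightarrow> f q = g q" "f differentiable (at p)"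
  shows "g differentiable (at p)"
  using assms has_derivative_transform_within_open unfolding differentiable_def by blast

lemma partial_deriv_add:
  assumes "f differentiable (at p)" "g differentiable (at p)"
  shows "partial_deriv i (\<lambda>q. f q + g q) p = partial_deriv i f p + partial_deriv i g p"
  using partial_deriv_eqI[OF has_derivative_add[OF assms[THEN has_derivative_partial_deriv]]]
  by (simp add: partial_deriv_def)

lemma partial_deriv_diff:
  assumes "f differentiable (at p)" "g differentiable (at p)"
  shows "partial_deriv i (\<lambda>q. f q - g q) p = partial_deriv i f p - partial_deriv i g p"
  using partial_deriv_eqI[OF has_derivative_diff[OF assms[THEN has_derivative_partial_deriv]]]
  by (simp add: partial_deriv_def)

lemma partial_deriv_mult:
  fixes f g :: "real^'n::finite \<Rightarrow> real"
  assumes "f differentiable (at p)" "g differentiable (at p)"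
  shows "partial_deriv i (\<lambda>q. f q * g q) p = f p * partial_deriv i g p + partial_deriv i f p * g p"
  using partial_deriv_eqI[OF has_derivative_mult[OF assms[THEN has_derivative_partial_deriv]]]
  by (simp add: partial_deriv_def)

lemma partial_deriv_const: "partial_deriv i (\<lambda>q. c) p = 0"
  by (simp add: partial_deriv_def)

lemma partial_deriv_cmult:
  fixes f :: "real^'n::finite \<Rightarrow> real"
  assumes "f differentiable (at p)"
  shows "partial_deriv i (\<lambda>q. c * f q) p = c * partial_deriv i f p"
  using partial_deriv_mult[of "\<lambda>q. c" p f i] assms by (simp add: partial_deriv_const)

lemma partial_deriv_sum:
  assumes "\<And>k. k \<in> A \<Longrightarrow> f k differentiable (at p)"
  shows "partial_deriv i (\<lambda>q. \<Sum>k\<in>A. f k q) p = (\<Sum>k\<in>A. partial_deriv i (f k) p)"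
proof -
  have "((\<lambda>q. \<Sum>k\<in>A. f k q) has_derivative (\<lambda>v. \<Sum>k\<in>A. frechet_derivative (f k) (at p) v)) (at p)"
    by (intro has_derivative_sum has_derivative_partial_deriv assms)
  from partial_deriv_eqI[OF this] show ?thesis
    by (simp add: partial_deriv_def)
qed

lemma has_real_derivative_along_axis:
  fixes f :: "real^'n::finite \<Rightarrow> real"
  assumes "f differentiable (at (p + t *\<^sub>R axis i 1))"
  shows "((\<lambda>s. f (p + s *\<^sub>R axis i 1)) has_real_derivative
           partial_deriv i f (p + t *\<^sub>R axis i 1)) (at t)"
proof -
  let ?D = "frechet_derivative f (at (p + t *\<^sub>R axis i 1))"
  interpret l: linear ?D
    using assms by (rule linear_frechet_derivative)
  have "((\<lambda>s. p + s *\<^sub>R axis i 1) has_derivative (\<lambda>h. h *\<^sub>R axis i 1)) (at t)"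
    by (auto intro!: derivative_eq_intros)
  from has_derivative_compose[OF this has_derivative_partial_deriv[OF assms]]
  have "((\<lambda>s. f (p + s *\<^sub>R axis i 1)) has_derivative (\<lambda>h. ?D (h *\<^sub>R axis i 1))) (at t)" .
  moreover have "(\<lambda>h. ?D (h *\<^sub>R axis i 1)) = (*) (partial_deriv i f (p + t *\<^sub>R axis i 1))"
    by (rule ext) (simp add: l.scaleR partial_deriv_def)
  ultimately show ?thesis
    unfolding has_field_derivative_def by simp
qed

section \<open>Locality and components of the regularity class \<open>Ck_on\<close>\<close>

lemma Ck_on_cong:
  assumes "open S" "\<And>p. p \<in> S \<Longrightarrow> f p = g p" "Ck_on k f S"
  shows "Ck_on k g S"
  using assms(2,3)
proof (induction k arbitrary: f g)
  case 0
  then show ?case using continuous_on_cong[of S S f g] by simp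
next
  case (Suc k)
  have fg: "f p = g p" if "p \<in> S" for p by (rule Suc.prems(1)[OF that])
  have f: "f differentiable (at p)" if "p \<in> S" for p
    using Suc.prems(2) that by simp
  have "g differentiable (at p)" if "p \<in> S" for p
    using assms(1) that fg f[OF that] by (rule differentiable_cong_open)
  moreover have "Ck_on k (partial_deriv i g) S" for i
  proof (rule Suc.IH)
    show "partial_deriv i f p = partial_deriv i g p" if "p \<in> S" for p
      using assms(1) that fg f[OF that] by (rule partial_deriv_cong)
    show "Ck_on k (partial_deriv i f) S" using Suc.prems(2) by simp
  qed
  ultimately show ?case by simp
qed

lemma partial_deriv_component:
  fixes f :: "real^'n::finite \<Rightarrow> real^'m::finite"
  assumes "f differentiable (at p)"
  shows "(\<lambda>q. f q $ j) differentiable (at p)"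
    and "frechet_derivative (\<lambda>q. f q $ j) (at p) v = frechet_derivative f (at p) v $ j"
proof -
  have "((\<lambda>q. f q $ j) has_derivative (\<lambda>h. frechet_derivative f (at p) h $ j)) (at p)"
    by (rule bounded_linear.has_derivative[OF bounded_linear_vec_nth has_derivative_partial_deriv[OF assms]])
  then show "(\<lambda>q. f q $ j) differentiable (at p)"
    "frechet_derivative (\<lambda>q. f q $ j) (at p) v = frechet_derivative f (at p) v $ j"
    by (auto simp: differentiable_def frechet_derivative_at [symmetric])
qed

lemma Ck_on_component:
  fixes f :: "real^'n::finite \<Rightarrow> real^'m::finite"
  assumes "open S" "Ck_on k f S"
  shows "Ck_on k (\<lambda>p. f p $ j) S"
  using assms(2)
proof (induction k arbitrary: f)
  case 0
  then show ?case by (auto intro!: continuous_intros)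
next
  case (Suc k)
  have "Ck_on k (partial_deriv i (\<lambda>p. f p $ j)) S" for i
  proof (rule Ck_on_cong[OF assms(1)])
    show "partial_deriv i f p $ j = partial_deriv i (\<lambda>p. f p $ j) p" if "p \<in> S" for p
      using Suc.prems that partial_deriv_component(2)[of f p j] by (simp add: partial_deriv_def)
    show "Ck_on k (\<lambda>p. partial_deriv i f p $ j) S"
      using Suc by simp
  qed
  then show ?case using Suc.prems partial_deriv_component(1)[of f _ j] by simp
qed

text \<open>\<open>y\<close> may take an end point of \<open>I\<close> as a value, and its maximum
  can well be one, so \<open>G\<close> is differentiable only within \<open>I\<close>. The chain
  rule is therefore applied within \<open>S\<close>, whose image lies in \<open>I\<close>; since
  \<open>S\<close> is open, the result is a full derivative at \<open>p\<close>.\<close>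

lemma partial_deriv_chain_within:
  fixes y :: "real^'n::finite \<Rightarrow> real"
  assumes "open S" "p \<in> S" "y ` S \<subseteq> I" "y differentiable (at p)"
    and G: "(G has_real_derivative d) (at (y p) within I)"
  shows "(\<lambda>q. G (y q)) differentiable (at p)"
    and "partial_deriv i (\<lambda>q. G (y q)) p = d * partial_deriv i y p"
proof -
  have "(y has_derivative frechet_derivative y (at p)) (at p within S)"
    by (rule has_derivative_at_withinI[OF has_derivative_partial_deriv[OF assms(4)]])
  moreover have "(G has_derivative (*) d) (at (y p) within y ` S)"
    using G assms(3) unfolding has_field_derivative_def by (rule has_derivative_subset)
  ultimately have "((\<lambda>q. G (y q)) has_derivative (\<lambda>h. d * frechet_derivative y (at p) h)) (at p within S)"
    by (rule has_derivative_in_compose)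
  then have *: "((\<lambda>q. G (y q)) has_derivative (\<lambda>h. d * frechet_derivative y (at p) h)) (at p)"
    using at_within_open[OF assms(2,1)] by simp
  then show "(\<lambda>q. G (y q)) differentiable (at p)"
    unfolding differentiable_def by blast
  show "partial_deriv i (\<lambda>q. G (y q)) p = d * partial_deriv i y p"
    using partial_deriv_eqI[OF *] by (simp add: partial_deriv_def)
qed

text \<open>The second difference is symmetric in \<open>i\<close> and \<open>j\<close>, so
  exchanging the indices represents one number by either mixed derivative. The points that occur lie
  within \<open>2 * h\<close> of \<open>p\<close>, and \<open>3 * h\<close> leaves room for an open
  ball.\<close>

lemma second_difference_quotient:
  fixes f :: "real^'n::finite \<Rightarrow> real"
  assumes "0 < h"
    and f: "\<And>q. q \<in> ball p (3 * h) \<Longrightarrow> f differentiable (at q)"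
    and fi: "\<And>q. q \<in> ball p (3 * h) \<Longrightarrow> partial_deriv i f differentiable (at q)"
  obtains q where "q \<in> ball p (3 * h)"
    "f (p + h *\<^sub>R axis i 1 + h *\<^sub>R axis j 1) - f (p + h *\<^sub>R axis i 1) - f (p + h *\<^sub>R axis j 1) + f p
       = h * (h * partial_deriv j (partial_deriv i f) q)"
proof -
  let ?i = "axis i 1 :: real^'n" and ?j = "axis j 1 :: real^'n"
  have mem: "p + s *\<^sub>R ?i + t *\<^sub>R ?j \<in> ball p (3 * h)" if "0 \<le> s" "s \<le> h" "0 \<le> t" "t \<le> h" for s t
  proof -
    have "norm (s *\<^sub>R ?i + t *\<^sub>R ?j) \<le> s + t"
      using that norm_triangle_ineq[of "s *\<^sub>R ?i" "t *\<^sub>R ?j"] by simp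
    then have "norm (s *\<^sub>R ?i + t *\<^sub>R ?j) < 3 * h" using that \<open>0 < h\<close> by linarith
    moreover have "dist p (p + s *\<^sub>R ?i + t *\<^sub>R ?j) = norm (s *\<^sub>R ?i + t *\<^sub>R ?j)"
      by (subst dist_commute) (simp add: dist_norm add.assoc)
    ultimately show ?thesis by simp
  qed
  \<comment> \<open>The difference in direction \<open>j\<close> as a function of the displacement
    in direction \<open>i\<close>: \<open>g h - g 0\<close> is the second difference, so one mean
    value in \<open>s\<close> and one in \<open>t\<close> produce the mixed derivative.\<close>
  define g where "g s = f (p + s *\<^sub>R ?i + h *\<^sub>R ?j) - f (p + s *\<^sub>R ?i)" for s
  have "(g has_real_derivative
      (partial_deriv i f (p + s *\<^sub>R ?i + h *\<^sub>R ?j) - partial_deriv i f (p + s *\<^sub>R ?i))) (at s)"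
    if s: "0 \<le> s" "s \<le> h" for s
  proof -
    have 1: "f differentiable (at ((p + h *\<^sub>R ?j) + s *\<^sub>R ?i))" "f differentiable (at (p + s *\<^sub>R ?i))"
      using f[OF mem[OF s, of h]] f[OF mem[OF s, of 0]] \<open>0 < h\<close> by (simp_all add: ac_simps)
    show ?thesis
      using DERIV_diff[OF has_real_derivative_along_axis[OF 1(1)] has_real_derivative_along_axis[OF 1(2)]]
      by (simp add: g_def[abs_def] ac_simps)
  qed
  from MVT2[OF \<open>0 < h\<close> this] obtain s where s: "0 < s" "s < h"
    "g h - g 0 = h * (partial_deriv i f (p + s *\<^sub>R ?i + h *\<^sub>R ?j) - partial_deriv i f (p + s *\<^sub>R ?i))"
    by auto
  have "((\<lambda>t. partial_deriv i f (p + s *\<^sub>R ?i + t *\<^sub>R ?j)) has_real_derivative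
      partial_deriv j (partial_deriv i f) (p + s *\<^sub>R ?i + t *\<^sub>R ?j)) (at t)" if "0 \<le> t" "t \<le> h" for t
    by (rule has_real_derivative_along_axis[OF fi[OF mem]]) (use s that in auto)
  from MVT2[OF \<open>0 < h\<close> this] obtain t where t: "0 < t" "t < h"
    "partial_deriv i f (p + s *\<^sub>R ?i + h *\<^sub>R ?j) - partial_deriv i f (p + s *\<^sub>R ?i + 0 *\<^sub>R ?j) =
      h * partial_deriv j (partial_deriv i f) (p + s *\<^sub>R ?i + t *\<^sub>R ?j)"
    by auto
  show thesis
    by (rule that[OF mem[of s t]]) (use s t in \<open>simp_all add: g_def\<close>)
qed

text \<open>Schwarz's theorem: both mixed derivatives take the same value, at two possibly different
  points as close to \<open>p\<close> as desired, and continuity carries the equality to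
  \<open>p\<close>.\<close>

lemma partial_deriv_commute:
  fixes f :: "real^'n::finite \<Rightarrow> real"
  assumes "open S" "p \<in> S"
    and f: "\<And>q. q \<in> S \<Longrightarrow> f differentiable (at q)"
    and fi: "\<And>q i. q \<in> S \<Longrightarrow> partial_deriv i f differentiable (at q)"
    and cont: "\<And>i j. continuous_on S (partial_deriv i (partial_deriv j f))"
  shows "partial_deriv i (partial_deriv j f) p = partial_deriv j (partial_deriv i f) p"
proof (rule ccontr)
  let ?A = "partial_deriv i (partial_deriv j f)" and ?B = "partial_deriv j (partial_deriv i f)"
  assume "?A p \<noteq> ?B p"
  then have e: "\<bar>?A p - ?B p\<bar> / 2 > 0" by simp
  have "isCont ?A p" "isCont ?B p"
    using cont assms(1,2) by (auto simp: continuous_on_eq_continuous_at)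
  then obtain d1 where d1: "d1 > 0" "\<And>q. dist q p < d1 \<Longrightarrow> dist (?A q) (?A p) < \<bar>?A p - ?B p\<bar> / 2"
    using e unfolding continuous_at_eps_delta by blast
  obtain d2 where d2: "d2 > 0" "\<And>q. dist q p < d2 \<Longrightarrow> dist (?B q) (?B p) < \<bar>?A p - ?B p\<bar> / 2"
    using e \<open>isCont ?B p\<close> unfolding continuous_at_eps_delta by blast
  note d = d1(1) d2(1) d1(2) d2(2)
  obtain r where r: "r > 0" "ball p r \<subseteq> S"
    using assms(1,2) openE by blast
  define h where "h = min r (min d1 d2) / 3"
  have h: "h > 0" "3 * h \<le> r" "3 * h \<le> d1" "3 * h \<le> d2"
    using r d by (auto simp: h_def)
  then have sub: "q \<in> S" if "q \<in> ball p (3 * h)" for q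
    using that r by auto
  obtain q1 where q1: "q1 \<in> ball p (3 * h)"
    "f (p + h *\<^sub>R axis j 1 + h *\<^sub>R axis i 1) - f (p + h *\<^sub>R axis j 1) - f (p + h *\<^sub>R axis i 1) + f p
       = h * (h * ?A q1)"
    using second_difference_quotient[OF h(1) f[OF sub] fi[OF sub]] by blast
  obtain q2 where q2: "q2 \<in> ball p (3 * h)"
    "f (p + h *\<^sub>R axis i 1 + h *\<^sub>R axis j 1) - f (p + h *\<^sub>R axis i 1) - f (p + h *\<^sub>R axis j 1) + f p
       = h * (h * ?B q2)"
    using second_difference_quotient[OF h(1) f[OF sub] fi[OF sub]] by blast
  have "h * (h * ?A q1) = h * (h * ?B q2)"
    using q1(2) q2(2) by (simp add: algebra_simps)
  then have "?A q1 = ?B q2" using h(1) by simp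
  moreover have "dist (?A q1) (?A p) < \<bar>?A p - ?B p\<bar> / 2" "dist (?B q2) (?B p) < \<bar>?A p - ?B p\<bar> / 2"
    using d(3)[of q1] d(4)[of q2] q1(1) q2(1) h by (simp_all add: dist_commute)
  ultimately show False
    unfolding dist_real_def by (smt (verit) field_sum_of_halves)
qed

section \<open>Necessary conditions at a maximum and the Gaussian barrier\<close>

lemma partial_deriv_at_local_max:
  fixes w :: "real^'n::finite \<Rightarrow> real"
  assumes "open S" "q \<in> S"
    and w: "\<And>p. p \<in> S \<Longrightarrow> w differentiable (at p)"
    and wi: "partial_deriv i w differentiable (at q)"
    and max: "\<And>p. p \<in> S \<Longrightarrow> w p \<le> w q"
  shows "partial_deriv i w q = 0" "partial_deriv i (partial_deriv i w) q \<le> 0"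
proof -
  let ?e = "axis i 1 :: real^'n"
  obtain r where r: "r > 0" "ball q r \<subseteq> S"
    using assms(1,2) openE by blast
  have mem: "q + t *\<^sub>R ?e \<in> S" if "\<bar>t\<bar> < r" for t
    using that r by (intro subsetD[OF r(2)]) (simp add: dist_norm)
  have d: "((\<lambda>s. w (q + s *\<^sub>R ?e)) has_real_derivative partial_deriv i w (q + t *\<^sub>R ?e)) (at t)"
    if "\<bar>t\<bar> < r" for t
    by (rule has_real_derivative_along_axis[OF w[OF mem[OF that]]])
  show 1: "partial_deriv i w q = 0"
    using DERIV_local_max[OF d[of 0] r(1)] r(1) max mem by simp
  have dd: "((\<lambda>s. partial_deriv i w (q + s *\<^sub>R ?e)) has_real_derivative
      partial_deriv i (partial_deriv i w) q) (at 0)"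
    using has_real_derivative_along_axis[of "partial_deriv i w" q 0 i] wi by simp
  show "partial_deriv i (partial_deriv i w) q \<le> 0"
  proof (rule ccontr)
    assume "\<not> ?thesis"
    then obtain d where d': "d > 0" "\<And>h. 0 < h \<Longrightarrow> h < d \<Longrightarrow> 0 < partial_deriv i w (q + h *\<^sub>R ?e)"
      using DERIV_pos_inc_right[OF dd] 1 by auto
    \<comment> \<open>Small enough that the segment from \<open>q\<close> stays in \<open>S\<close>
      and the derivative along it stays positive; \<open>w\<close> then increases away from its
      maximum.\<close>
    define b where "b = min d r / 2"
    have b: "0 < b" "b < d" "b < r" using d' r by (auto simp: b_def)
    obtain z where z: "0 < z" "z < b"
      "w (q + b *\<^sub>R ?e) - w (q + 0 *\<^sub>R ?e) = (b - 0) * partial_deriv i w (q + z *\<^sub>R ?e)"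
      using MVT2[OF b(1), of "\<lambda>s. w (q + s *\<^sub>R ?e)" "\<lambda>s. partial_deriv i w (q + s *\<^sub>R ?e)"] d b by auto
    then have "w (q + b *\<^sub>R ?e) > w q"
      using b d'(2)[of z] mult_pos_pos[of b "partial_deriv i w (q + z *\<^sub>R ?e)"] by (simp add: algebra_simps)
    then show False
      using max[OF mem[of b]] b by simp
  qed
qed

definition laplacian :: "(real^'n::finite \<Rightarrow> real) \<Rightarrow> real^'n \<Rightarrow> real" where
  "laplacian u p = (\<Sum>i\<in>UNIV. partial_deriv i (partial_deriv i u) p)"

text \<open>Hopf's barrier. For positive \<open>a\<close> the Laplacian is positive once
  \<open>2 * a * (dist p c)^2\<close> exceeds the dimension, so a large \<open>a\<close> makes it
  positive on any set bounded away from \<open>c\<close>; \<open>b\<close> will normalise the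
  barrier to 0 on a sphere about \<open>c\<close>.\<close>

lemma gaussian_partial_derivs:
  fixes c :: "real^'n::finite" and a b :: real
  defines "v \<equiv> \<lambda>p. exp (- a * (dist p c)\<^sup>2) - b"
  shows "v differentiable (at p)"
    and "partial_deriv i v p = - 2 * a * (p $ i - c $ i) * exp (- a * (dist p c)\<^sup>2)"
    and "partial_deriv i v differentiable (at p)"
    and "laplacian v p = (4 * a\<^sup>2 * (dist p c)\<^sup>2 - 2 * a * CARD('n)) * exp (- a * (dist p c)\<^sup>2)"
proof -
  let ?E = "\<lambda>p. exp (- a * (dist p c)\<^sup>2)"
  have E: "(?E has_derivative (\<lambda>h. - 2 * a * ((p - c) \<bullet> h) * ?E p)) (at p)" for p
  proof -
    have "((\<lambda>p. p - c) has_derivative (\<lambda>h. h)) (at p)"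
      using has_derivative_diff[OF has_derivative_ident has_derivative_const] by simp
    from has_derivative_mult_right[OF has_derivative_inner[OF this this], of "- a"]
    have "((\<lambda>p. - a * ((p - c) \<bullet> (p - c))) has_derivative (\<lambda>h. - 2 * a * ((p - c) \<bullet> h))) (at p)"
      by (rule has_derivative_eq_rhs) (auto simp: inner_commute algebra_simps)
    from has_derivative_exp[OF this] show ?thesis
      by (simp add: dist_norm power2_norm_eq_inner mult_ac)
  qed
  have v: "(v has_derivative (\<lambda>h. - 2 * a * ((p - c) \<bullet> h) * ?E p)) (at p)" for p
    unfolding v_def using has_derivative_diff[OF E has_derivative_const[of b]] by simp
  then show "v differentiable (at p)"
    unfolding differentiable_def by blast
  have d1: "partial_deriv i v = (\<lambda>p. - 2 * a * ((p $ i - c $ i) * ?E p))" for i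
    by (rule ext) (simp add: partial_deriv_eqI[OF v] inner_axis)
  then show "partial_deriv i v p = - 2 * a * (p $ i - c $ i) * ?E p" by simp
  have l: "((\<lambda>p. p $ i) has_derivative (\<lambda>h. h $ i)) (at p)" for i p
    by (rule bounded_linear.has_derivative[OF bounded_linear_vec_nth has_derivative_ident])
  have d2: "(partial_deriv i v has_derivative (\<lambda>h. - 2 * a * ((h $ i) * ?E p
      + (p $ i - c $ i) * (- 2 * a * ((p - c) \<bullet> h) * ?E p)))) (at p)" for i p
  proof -
    have "((\<lambda>p. p $ i - c $ i) has_derivative (\<lambda>h. h $ i)) (at p)"
      using has_derivative_diff[OF l has_derivative_const] by simp
    from has_derivative_mult_right[OF has_derivative_mult[OF this E], of "- 2 * a"]
    show ?thesis unfolding d1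
      by (rule has_derivative_eq_rhs) (auto simp: algebra_simps)
  qed
  then show "partial_deriv i v differentiable (at p)"
    unfolding differentiable_def by blast
  have "laplacian v p = (\<Sum>i\<in>UNIV. - 2 * a * ?E p + 4 * a\<^sup>2 * ?E p * ((p - c) $ i * (p - c) $ i))"
    unfolding laplacian_def
    by (rule sum.cong[OF refl]) (simp add: partial_deriv_eqI[OF d2] inner_axis power2_eq_square algebra_simps)
  also have "\<dots> = - 2 * a * ?E p * CARD('n) + 4 * a\<^sup>2 * ?E p * (\<Sum>i\<in>UNIV. (p - c) $ i * (p - c) $ i)"
    by (simp add: sum.distrib sum_subtractf sum_distrib_left)
  also have "(\<Sum>i\<in>UNIV. (p - c) $ i * (p - c) $ i) = (dist p c)\<^sup>2"
    by (simp add: dist_norm power2_norm_eq_inner inner_vec_def)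
  finally show "laplacian v p = (4 * a\<^sup>2 * (dist p c)\<^sup>2 - 2 * a * CARD('n)) * ?E p"
    by (simp add: algebra_simps)
qed

section \<open>Strong maximum principle\<close>

lemma laplacian_add_cmult:
  fixes u v :: "real^'n::finite \<Rightarrow> real"
  assumes "open S" "p \<in> S"
    and u: "\<And>q. q \<in> S \<Longrightarrow> u differentiable (at q)"
    and v: "\<And>q. q \<in> S \<Longrightarrow> v differentiable (at q)"
    and ui: "\<And>i. partial_deriv i u differentiable (at p)"
    and vi: "\<And>i. partial_deriv i v differentiable (at p)"
  shows "partial_deriv i (\<lambda>q. u q + e * v q) differentiable (at p)"
    and "laplacian (\<lambda>q. u q + e * v q) p = laplacian u p + e * laplacian v p"
proof -
  have 1: "partial_deriv i u q + e * partial_deriv i v q = partial_deriv i (\<lambda>q. u q + e * v q) q"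
    if "q \<in> S" for i q
    using u[OF that] v[OF that] by (simp add: partial_deriv_add partial_deriv_cmult)
  have 2: "(\<lambda>q. partial_deriv i u q + e * partial_deriv i v q) differentiable (at p)" for i
    using ui vi by simp
  show "partial_deriv i (\<lambda>q. u q + e * v q) differentiable (at p)"
    by (rule differentiable_cong_open[OF assms(1,2) 1 2])
  have "partial_deriv i (partial_deriv i (\<lambda>q. u q + e * v q)) p
      = partial_deriv i (partial_deriv i u) p + e * partial_deriv i (partial_deriv i v) p" for i
    using partial_deriv_cong[OF assms(1,2) 1 2, of i i] ui vi
    by (simp add: partial_deriv_add partial_deriv_cmult)
  then show "laplacian (\<lambda>q. u q + e * v q) p = laplacian u p + e * laplacian v p"
    by (simp add: laplacian_def sum.distrib sum_distrib_left)
qed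

text \<open>The perturbation \<open>v\<close> is negative outside \<open>cball c R\<close>, where
  \<open>y\<close> may reach its maximum, while inside the ball \<open>y\<close> has room below
  \<open>y q\<close>. Hence \<open>w = y + \<epsilon> * v\<close>, which equals \<open>y q\<close>
  at \<open>q\<close>, stays below this value on a small sphere about \<open>q\<close> and has an
  interior maximum, where its Laplacian turns out to be positive.\<close>

lemma max_set_no_touching_ball:
  fixes y :: "real^'n::finite \<Rightarrow> real"
  assumes "open S"
    and y: "\<And>p. p \<in> S \<Longrightarrow> y differentiable (at p)"
    and yi: "\<And>p i. p \<in> S \<Longrightarrow> partial_deriv i y differentiable (at p)"
    and sub: "\<And>p. p \<in> S \<Longrightarrow> \<exists>i. partial_deriv i y p \<noteq> 0 \<Longrightarrow>
                laplacian y p \<ge> - C * (\<Sum>i\<in>UNIV. (partial_deriv i y p)\<^sup>2)"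
    and max: "\<And>p. p \<in> S \<Longrightarrow> y p \<le> y q"
    and q: "q \<in> S" "dist q c = R" "R > 0"
    and less: "\<And>p. p \<in> S \<Longrightarrow> p \<in> cball c R \<Longrightarrow> p \<noteq> q \<Longrightarrow> y p < y q"
  shows False
proof -
  obtain \<rho>0 where \<rho>0: "\<rho>0 > 0" "cball q \<rho>0 \<subseteq> S"
    using \<open>open S\<close> q(1) open_contains_cball by blast
  \<comment> \<open>The bound \<open>R / 2\<close> keeps \<open>K\<close> at distance at least
    \<open>R / 2\<close> from \<open>c\<close>, the only zero of the gradient of the
    Gaussian.\<close>
  define \<rho> where "\<rho> = min \<rho>0 (R / 2)"
  have \<rho>: "\<rho> > 0" "\<rho> \<le> R / 2" "cball q \<rho> \<subseteq> S"
    using \<rho>0 q by (auto simp: \<rho>_def)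
  define K where "K = cball q \<rho>"
  have far: "R / 2 \<le> dist p c" if "p \<in> K" for p
    using that \<rho>(2) q(2) dist_triangle[of q c p] by (auto simp: K_def)
  define n where "n = real CARD('n)"
  \<comment> \<open>Chosen so that \<open>\<alpha> * (R / 2)^2 = n + 1\<close>. Half of the leading
    term \<open>4 * \<alpha>^2 * (dist m c)^2\<close> will be spent on the gradient term, and what
    remains has the sign of \<open>\<alpha> * (dist m c)^2 - n\<close>.\<close>
  define \<alpha> where "\<alpha> = 4 * (n + 1) / R\<^sup>2"
  have n: "n \<ge> 1" unfolding n_def by (simp add: Suc_leI)
  have \<alpha>: "\<alpha> > 0" using n q by (simp add: \<alpha>_def)
  have \<alpha>far: "\<alpha> * (dist p c)\<^sup>2 \<ge> n + 1" if "p \<in> K" for p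
  proof -
    have "(R / 2)\<^sup>2 \<le> (dist p c)\<^sup>2"
      using far[OF that] q(3) by (intro power_mono) auto
    then have "\<alpha> * (R / 2)\<^sup>2 \<le> \<alpha> * (dist p c)\<^sup>2"
      using \<alpha> by simp
    moreover have "\<alpha> * (R / 2)\<^sup>2 = n + 1"
      using q(3) by (simp add: \<alpha>_def power2_eq_square)
    ultimately show ?thesis by simp
  qed
  define E where "E p = exp (- \<alpha> * (dist p c)\<^sup>2)" for p
  define v where "v p = E p - E q" for p
  note v_derivs = gaussian_partial_derivs[where a = \<alpha> and b = "E q" and c = c, folded E_def, folded v_def[abs_def], folded n_def]
  have E: "0 < E p" "E p \<le> 1" for p
    using \<alpha> by (auto simp: E_def)
  have v0: "v p < 0" if "R < dist p c" for p
    using that q \<alpha> by (auto simp: v_def E_def intro: power_strict_mono)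
  have v1: "v p \<le> 1" for p
    using E[of p] E[of q] by (simp add: v_def)
  \<comment> \<open>The part of the small sphere on which \<open>v\<close> may be positive. It is
    compact and misses \<open>q\<close>, so \<open>y\<close> stays below \<open>y q\<close> on it by
    a fixed gap \<open>\<delta>\<close>; for empty \<open>L\<close> any positive number
    serves.\<close>
  define L where "L = sphere q \<rho> \<inter> cball c R"
  have "compact L" unfolding L_def by (intro compact_Int_closed) auto
  have "continuous_on L y"
    using y \<rho>(3) sphere_cball[of q \<rho>] unfolding L_def
    by (intro continuous_at_imp_continuous_on ballI differentiable_imp_continuous_within) auto
  have Lless: "y p < y q" if "p \<in> L" for p
    using that less[of p] \<rho> by (auto simp: L_def)
  obtain \<delta> where \<delta>: "\<delta> > 0" "\<And>p. p \<in> L \<Longrightarrow> y p \<le> y q - \<delta>"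
  proof (cases "L = {}")
    case True
    then show ?thesis using that[of 1] by simp
  next
    case False
    then obtain m where m: "m \<in> L" "\<And>p. p \<in> L \<Longrightarrow> y p \<le> y m"
      using continuous_attains_sup[OF \<open>compact L\<close> _ \<open>continuous_on L y\<close>] by blast
    then show ?thesis using that[of "y q - y m"] Lless by auto
  qed
  \<comment> \<open>As \<open>v\<close> is at most 1, the first entry keeps
    \<open>\<epsilon> * v\<close> below the gap \<open>\<delta>\<close>; the second gives
    \<open>C * \<epsilon> \<le> 1 / 2\<close>, with \<open>\<bar>C\<bar> + 1\<close> as a positive
    denominator for \<open>C\<close> of either sign.\<close>
  define \<epsilon> where "\<epsilon> = min (\<delta> / 2) (1 / (2 * (\<bar>C\<bar> + 1)))"
  have \<epsilon>: "\<epsilon> > 0" "\<epsilon> < \<delta>" "C * \<epsilon> \<le> 1 / 2"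
  proof -
    show "\<epsilon> > 0" "\<epsilon> < \<delta>" using \<delta>(1) by (auto simp: \<epsilon>_def min_less_iff_disj)
    have "C * \<epsilon> \<le> (\<bar>C\<bar> + 1) * \<epsilon>" using \<open>\<epsilon> > 0\<close> by (intro mult_right_mono) auto
    also have "\<dots> \<le> (\<bar>C\<bar> + 1) * (1 / (2 * (\<bar>C\<bar> + 1)))"
      by (intro mult_left_mono) (auto simp: \<epsilon>_def)
    also have "\<dots> = 1 / 2" by (simp add: field_simps)
    finally show "C * \<epsilon> \<le> 1 / 2" .
  qed
  define w where "w p = y p + \<epsilon> * v p" for p
  have wdiff: "w differentiable (at p)" if "p \<in> S" for p
    unfolding w_def[abs_def] using y[OF that] v_derivs(1) by simp
  have wq: "w q = y q" by (simp add: w_def v_def)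
  have bdry: "w p < y q" if p: "p \<in> sphere q \<rho>" for p
  proof (cases "dist p c \<le> R")
    case True
    then have "p \<in> L" using p by (simp add: L_def dist_commute)
    then have "y p \<le> y q - \<delta>" by (rule \<delta>)
    moreover have "\<epsilon> * v p \<le> \<epsilon> * 1" using v1 \<epsilon> by (intro mult_left_mono) auto
    ultimately show ?thesis using \<epsilon>(2) unfolding w_def by linarith
  next
    case False
    then have "\<epsilon> * v p < 0" using v0 \<epsilon> by (simp add: mult_pos_neg)
    moreover have "y p \<le> y q" using p \<rho>(3) sphere_cball[of q \<rho>] by (intro max) auto
    ultimately show ?thesis by (simp add: w_def)
  qed
  have "continuous_on K w"
    using wdiff \<rho>(3) unfolding K_def
    by (intro continuous_at_imp_continuous_on ballI differentiable_imp_continuous_within) auto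
  moreover have "compact K" "K \<noteq> {}" using \<rho>(1) by (auto simp: K_def)
  ultimately obtain m where m: "m \<in> K" "\<And>p. p \<in> K \<Longrightarrow> w p \<le> w m"
    using continuous_attains_sup[of K w] by blast
  have "y q \<le> w m" using m(2)[of q] wq \<rho>(1) by (simp add: K_def)
  then have mball: "m \<in> ball q \<rho>"
    using bdry[of m] m(1) by (auto simp: K_def less_le)
  have ballS: "ball q \<rho> \<subseteq> S" using \<rho>(3) ball_subset_cball by blast
  then have mS: "m \<in> S" using mball by blast
  have wi: "partial_deriv i w differentiable (at m)" for i
    unfolding w_def[abs_def]
    by (rule laplacian_add_cmult(1)[OF \<open>open S\<close> mS]) (use y yi v_derivs mS in auto)
  have lap: "laplacian w m = laplacian y m + \<epsilon> * laplacian v m"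
    unfolding w_def[abs_def]
    by (rule laplacian_add_cmult(2)[OF \<open>open S\<close> mS]) (use y yi v_derivs mS in auto)
  have crit: "partial_deriv i w m = 0" "partial_deriv i (partial_deriv i w) m \<le> 0" for i
  proof -
    have *: "w differentiable (at p)" "w p \<le> w m" if "p \<in> ball q \<rho>" for p
      using that ballS wdiff m(2) by (auto simp: K_def)
    show "partial_deriv i w m = 0" "partial_deriv i (partial_deriv i w) m \<le> 0"
      using partial_deriv_at_local_max[OF open_ball mball *(1) wi *(2)] by blast+
  qed
  then have "laplacian w m \<le> 0"
    unfolding laplacian_def by (intro sum_nonpos) auto
  have grad: "partial_deriv i y m = 2 * \<epsilon> * \<alpha> * E m * (m $ i - c $ i)" for i
  proof -
    have "partial_deriv i w m = partial_deriv i y m + \<epsilon> * partial_deriv i v m"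
      unfolding w_def[abs_def] using y[OF mS] v_derivs(1) by (simp add: partial_deriv_add partial_deriv_cmult)
    then show ?thesis using crit(1)[of i] v_derivs(2)[of i m] by simp
  qed
  \<comment> \<open>Some component of the gradient of \<open>y\<close> is nonzero at
    \<open>m\<close>; this is what admits \<open>m\<close> to the hypothesis
    \<open>sub\<close>.\<close>
  have "m \<noteq> c" using far[OF m(1)] q(3) by auto
  then obtain i where "m $ i \<noteq> c $ i"
    by (auto simp: vec_eq_iff)
  then have "partial_deriv i y m \<noteq> 0"
    using grad[of i] \<epsilon>(1) \<alpha> E(1)[of m] by simp
  then have "laplacian y m \<ge> - C * (\<Sum>i\<in>UNIV. (partial_deriv i y m)\<^sup>2)"
    using sub[OF mS] by blast
  also have "(\<Sum>i\<in>UNIV. (partial_deriv i y m)\<^sup>2) = (2 * \<epsilon> * \<alpha> * E m)\<^sup>2 * (dist m c)\<^sup>2"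
    by (simp add: grad dist_norm power2_norm_eq_inner inner_vec_def sum_distrib_left power_mult_distrib
        power2_eq_square[of "_ $ _ - _ $ _"])
  finally have "laplacian y m \<ge> - (C * \<epsilon>) * (\<epsilon> * (4 * \<alpha>\<^sup>2 * (dist m c)\<^sup>2 * (E m * E m)))"
    by (simp add: power2_eq_square algebra_simps)
  \<comment> \<open>The gradient term carries \<open>\<epsilon>\<close> twice and \<open>E m\<close>
    twice: \<open>C * \<epsilon> \<le> 1 / 2\<close> and \<open>E m \<le> 1\<close> reduce it to
    half of the positive part of \<open>\<epsilon> * laplacian v m\<close>.\<close>
  moreover have "(C * \<epsilon>) * (\<epsilon> * (4 * \<alpha>\<^sup>2 * (dist m c)\<^sup>2 * (E m * E m)))
      \<le> 1 / 2 * (\<epsilon> * (4 * \<alpha>\<^sup>2 * (dist m c)\<^sup>2 * (1 * E m)))"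
  proof -
    have "(C * \<epsilon>) * (\<epsilon> * (4 * \<alpha>\<^sup>2 * (dist m c)\<^sup>2 * (E m * E m)))
        \<le> 1 / 2 * (\<epsilon> * (4 * \<alpha>\<^sup>2 * (dist m c)\<^sup>2 * (E m * E m)))"
      using \<epsilon>(3) by (rule mult_right_mono) (use \<epsilon>(1) E(1)[of m] in \<open>auto intro!: mult_nonneg_nonneg\<close>)
    also have "\<dots> \<le> 1 / 2 * (\<epsilon> * (4 * \<alpha>\<^sup>2 * (dist m c)\<^sup>2 * (1 * E m)))"
      using E[of m] \<epsilon>(1) by (intro mult_left_mono mult_right_mono) auto
    finally show ?thesis .
  qed
  ultimately have "laplacian w m \<ge> \<epsilon> * E m * (2 * \<alpha> * (\<alpha> * (dist m c)\<^sup>2 - n))"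
    unfolding lap v_derivs(4) by (simp add: power2_eq_square algebra_simps)
  moreover have "\<epsilon> * E m * (2 * \<alpha> * (\<alpha> * (dist m c)\<^sup>2 - n)) > 0"
    using \<epsilon>(1) E(1)[of m] \<alpha> \<alpha>far[OF m(1)] by (intro mult_pos_pos) auto
  ultimately show False using \<open>laplacian w m \<le> 0\<close> by simp
qed

text \<open>The set \<open>M\<close> of maximal points is closed in \<open>S\<close> by continuity,
  so connectedness reduces the claim to its openness. This is a local matter, which allows the
  search for a nearest maximal point to be confined to a closed ball inside
  \<open>S\<close>.\<close>

lemma strong_maximum_principle:
  fixes y :: "real^'n::finite \<Rightarrow> real"
  assumes "open S" "connected S"
    and y: "\<And>p. p \<in> S \<Longrightarrow> y differentiable (at p)"
    and yi: "\<And>p i. p \<in> S \<Longrightarrow> partial_deriv i y differentiable (at p)"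
    and sub: "\<And>p. p \<in> S \<Longrightarrow> \<exists>i. partial_deriv i y p \<noteq> 0 \<Longrightarrow>
                laplacian y p \<ge> - C * (\<Sum>i\<in>UNIV. (partial_deriv i y p)\<^sup>2)"
    and max: "\<And>p. p \<in> S \<Longrightarrow> y p \<le> y x0"
    and "x0 \<in> S" "p \<in> S"
  shows "y p = y x0"
proof -
  have cont: "continuous_on S y"
    using y by (intro continuous_at_imp_continuous_on ballI differentiable_imp_continuous_within)
  define M where "M = {p \<in> S. y p = y x0}"
  have "openin (top_of_set S) M"
  proof -
    have "\<exists>e>0. ball x e \<subseteq> M" if x: "x \<in> M" for x
    proof -
      have "x \<in> S" using x by (simp add: M_def)
      then obtain r where r: "r > 0" "cball x r \<subseteq> S"
        using \<open>open S\<close> open_contains_cball by blast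
      have "z \<in> M" if z: "z \<in> ball x (r / 2)" for z
      proof (rule ccontr)
        assume "z \<notin> M"
        \<comment> \<open>\<open>M\<close> is only relatively closed; cutting it with a closed ball
          inside \<open>S\<close> makes it closed, so a point of it nearest to \<open>z\<close>
          exists. As \<open>z\<close> is within \<open>r / 2\<close> of \<open>x\<close>, every
          maximal point at least as near to \<open>z\<close> as \<open>q\<close> still lies in
          \<open>cball x r\<close>.\<close>
        define A where "A = M \<inter> cball x r"
        have "A = {p \<in> cball x r. y p = y x0}"
          using r(2) by (auto simp: A_def M_def)
        then have "closed A"
          using continuous_closed_preimage_constant[OF continuous_on_subset[OF cont r(2)] closed_cball]
          by (simp only:)
        moreover have "x \<in> A" using x r by (simp add: A_def)
        ultimately obtain q where q: "q \<in> A" "\<And>a. a \<in> A \<Longrightarrow> dist z q \<le> dist z a"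
          using distance_attains_inf[of A z] by blast
        have zq: "dist z q < r / 2"
          using q(2)[OF \<open>x \<in> A\<close>] z by (simp add: dist_commute)
        have "q \<noteq> z" using \<open>z \<notin> M\<close> q(1) by (auto simp: A_def)
        \<comment> \<open>The sphere about \<open>z\<close> through \<open>q\<close> may contain
          further maximal points. The ball with diameter from \<open>z\<close> to \<open>q\<close>
          lies inside it and meets that sphere only at \<open>q\<close>, as the touching lemma
          demands.\<close>
        define c where "c = midpoint z q"
        define R where "R = dist z q / 2"
        have "R > 0" using \<open>q \<noteq> z\<close> by (simp add: R_def)
        have qc: "dist q c = R" "dist z c = R"
          by (simp_all add: c_def R_def dist_midpoint dist_commute)
        have yq: "y q = y x0" "q \<in> S" using q(1) by (auto simp: A_def M_def)
        show False
        proof (rule max_set_no_touching_ball[OF \<open>open S\<close> y yi sub _ \<open>q \<in> S\<close> qc(1) \<open>R > 0\<close>])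
          show "y p \<le> y q" if "p \<in> S" for p using max[OF that] yq by simp
          show "y p < y q" if p: "p \<in> S" "p \<in> cball c R" "p \<noteq> q" for p
          proof (rule ccontr)
            assume "\<not> y p < y q"
            then have "p \<in> M" using max[OF p(1)] p(1) yq by (auto simp: M_def)
            have "dist z p \<le> R + R"
              using dist_triangle[of z p c] p(2) qc(2) by simp
            then have zp: "dist z p \<le> dist z q" by (simp add: R_def)
            then have "dist x p \<le> r"
              using dist_triangle[of x p z] z zq by simp
            then have "p \<in> A" using \<open>p \<in> M\<close> by (simp add: A_def)
            then have "dist z p = dist z q" using q(2) zp by (simp add: antisym)
            \<comment> \<open>Equality in the triangle inequality through \<open>c\<close>:
              \<open>c - p\<close> and \<open>z - c\<close> are parallel vectors of equal length
              \<open>R\<close>, so \<open>p\<close> is the reflection of \<open>z\<close> in the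
              midpoint \<open>c\<close>, which is \<open>q\<close>.\<close>
            moreover have "dist c p \<le> R" using p(2) by simp
            ultimately have eq: "dist z p = dist z c + dist c p"
              using dist_triangle[of z p c] qc(2) by (simp add: R_def)
            then have "norm (z - p) = norm (z - c) + norm (c - p)"
              by (simp add: dist_norm)
            then have "norm ((z - c) + (c - p)) = norm (z - c) + norm (c - p)"
              by simp
            then have "norm (z - c) *\<^sub>R (c - p) = norm (c - p) *\<^sub>R (z - c)"
              by (simp only: norm_triangle_eq)
            moreover have "norm (z - c) = R" using qc(2) by (simp add: dist_norm)
            moreover have "norm (c - p) = R"
              using eq \<open>dist z p = dist z q\<close> qc(2) by (simp add: dist_norm R_def)
            ultimately have "c - p = z - c" using \<open>R > 0\<close> by simp
            then have "p = (2::real) *\<^sub>R c - z"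
              by (simp add: scaleR_2 algebra_simps)
            also have "\<dots> = q" by (simp add: c_def midpoint_def)
            finally show False using p(3) by simp
          qed
        qed
      qed
      then show ?thesis using r(1) by (intro exI[of _ "r / 2"]) auto
    qed
    then have "open M" by (simp add: open_contains_ball)
    then show ?thesis by (simp add: M_def open_subset)
  qed
  moreover have "closedin (top_of_set S) M"
    unfolding M_def by (rule continuous_closedin_preimage_constant[OF cont])
  ultimately have "M = {} \<or> M = S"
    using \<open>connected S\<close> connected_clopen by blast
  then show ?thesis using assms(7,8) by (auto simp: M_def)
qed

section \<open>Bump functions\<close>

text \<open>\<open>flat 0\<close> is the classical function \<open>exp (- 1 / x)\<close>, extended
  by 0. The powers of \<open>1 / x\<close> are included so that the span of the family is closed
  under differentiation.\<close>

definition flat :: "nat \<Rightarrow> real \<Rightarrow> real" where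
  "flat k x = (if x \<le> 0 then 0 else inverse x ^ k * exp (- inverse x))"

text \<open>With \<open>s = 1 / x\<close> the right-hand limit becomes that of
  \<open>s^k / exp s\<close> at infinity.\<close>

lemma isCont_flat_0: "isCont (flat k) 0"
proof -
  have "((\<lambda>s::real. s ^ k / exp s) \<longlongrightarrow> 0) at_top"
    by (rule tendsto_power_div_exp_0)
  then have "((\<lambda>x::real. inverse x ^ k / exp (inverse x)) \<longlongrightarrow> 0) (at_right 0)"
    by (rule filterlim_compose[OF _ filterlim_inverse_at_top_right])
  then have "(flat k \<longlongrightarrow> 0) (at_right 0)"
    by (rule Lim_transform_eventually)
      (auto simp: flat_def eventually_at_right_less exp_minus field_simps intro!: eventually_at_rightI[of 0 1])
  moreover have "(flat k \<longlongrightarrow> 0) (at_left 0)"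
    by (rule Lim_transform_eventually[OF tendsto_const])
      (auto simp: flat_def intro!: eventually_at_leftI[of "-1" 0])
  ultimately show ?thesis
    unfolding isCont_def by (simp add: filterlim_at_split flat_def)
qed

lemma DERIV_flat:
  "(flat k has_real_derivative flat (Suc (Suc k)) x - real k * flat (Suc k) x) (at x)"
proof (cases x "0 :: real" rule: linorder_cases)
  case less
  have "((\<lambda>x::real. 0::real) has_real_derivative 0) (at x)" by simp
  then have "(flat k has_real_derivative 0) (at x)"
    by (rule has_field_derivative_transform_within_open[of _ _ _ "{..<0}"]) (use less in \<open>auto simp: flat_def\<close>)
  then show ?thesis using less by (simp add: flat_def)
next
  case equal
  \<comment> \<open>At 0 the difference quotient of \<open>flat k\<close> is
    \<open>flat (Suc k)\<close> itself, so continuity of the next member gives the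
    derivative.\<close>
  have "((\<lambda>h. (flat k (0 + h) - flat k 0) / h) \<longlongrightarrow> 0) (at 0)"
  proof (rule Lim_transform_eventually)
    show "(flat (Suc k) \<longlongrightarrow> 0) (at 0)"
      using isCont_flat_0[of "Suc k"] by (simp add: isCont_def flat_def)
    show "\<forall>\<^sub>F h in at 0. flat (Suc k) h = (flat k (0 + h) - flat k 0) / h"
      by (auto simp: flat_def field_simps eventually_at intro!: exI[of _ 1])
  qed
  then show ?thesis using equal by (simp add: DERIV_def flat_def)
next
  case greater
  have "((\<lambda>x. inverse x ^ k * exp (- inverse x)) has_real_derivative
      flat (Suc (Suc k)) x - real k * flat (Suc k) x) (at x)"
  proof -
    have i: "(inverse has_real_derivative - (inverse x * inverse x)) (at x)"
      using DERIV_inverse[of x] greater by (simp add: power2_eq_square)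
    have e: "((\<lambda>x. exp (- inverse x)) has_real_derivative exp (- inverse x) * (inverse x * inverse x)) (at x)"
      using DERIV_fun_exp[OF DERIV_minus[OF i]] by simp
    show ?thesis
      using DERIV_mult[OF DERIV_power[OF i, of k] e] greater by (cases k) (simp_all add: flat_def algebra_simps)
  qed
  then show ?thesis
    by (rule has_field_derivative_transform_within_open[of _ _ _ "{0<..}"]) (use greater in \<open>auto simp: flat_def\<close>)
qed

text \<open>A class of functions closed under partial derivatives, so that its members are \<open>C\<^sup>\<infinity>\<close>.\<close>

inductive smooth_expr :: "(real^'n::finite \<Rightarrow> real) \<Rightarrow> bool" where
  const: "smooth_expr (\<lambda>p. a)"
| coord: "smooth_expr (\<lambda>p. p $ i)"
| add: "smooth_expr f \<Longrightarrow> smooth_expr g \<Longrightarrow> smooth_expr (\<lambda>p. f p + g p)"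
| mult: "smooth_expr f \<Longrightarrow> smooth_expr g \<Longrightarrow> smooth_expr (\<lambda>p. f p * g p)"
| flat: "smooth_expr f \<Longrightarrow> smooth_expr (\<lambda>p. flat k (f p))"

text \<open>Differentiability at every point is proved along with membership of the derivative,
  since the product and chain rules must identify derivatives as functions before the closure rules
  apply.\<close>

lemma smooth_expr_partial_deriv:
  fixes f :: "real^'n::finite \<Rightarrow> real"
  assumes "smooth_expr f"
  shows "f differentiable (at p) \<and> smooth_expr (partial_deriv i f)"
  using assms
proof (induction arbitrary: p rule: smooth_expr.induct)
  case (const a)
  have "partial_deriv i (\<lambda>p. a) = (\<lambda>p. 0)" by (rule ext) (rule partial_deriv_const)
  then show ?case by (simp add: smooth_expr.const)
next
  case (coord j)
  have d: "((\<lambda>p. p $ j) has_derivative (\<lambda>h. h $ j)) (at p)" for p :: "real^'n"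
    by (rule bounded_linear.has_derivative[OF bounded_linear_vec_nth has_derivative_ident])
  then have "(\<lambda>p::real^'n. p $ j) differentiable (at p)" for p
    unfolding differentiable_def by blast
  moreover have "partial_deriv i (\<lambda>p::real^'n. p $ j) = (\<lambda>p. axis i 1 $ j)"
    by (rule ext) (rule partial_deriv_eqI[OF d])
  ultimately show ?case by (simp add: smooth_expr.const)
next
  case (add f g)
  then have "partial_deriv i (\<lambda>p. f p + g p) = (\<lambda>p. partial_deriv i f p + partial_deriv i g p)"
    by (intro ext partial_deriv_add) auto
  then show ?case using add by (auto intro: smooth_expr.add)
next
  case (mult f g)
  then have "partial_deriv i (\<lambda>p. f p * g p) = (\<lambda>p. f p * partial_deriv i g p + partial_deriv i f p * g p)"
    by (intro ext partial_deriv_mult) auto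
  then show ?case using mult by (auto intro!: smooth_expr.add smooth_expr.mult)
next
  case (flat f k)
  have d: "((\<lambda>p. flat k (f p)) has_derivative
      (\<lambda>h. (flat (Suc (Suc k)) (f p) - real k * flat (Suc k) (f p)) * frechet_derivative f (at p) h)) (at p)" for p
    using has_derivative_compose[OF has_derivative_partial_deriv DERIV_flat[unfolded has_field_derivative_def]]
      flat.IH by blast
  then have "(\<lambda>p. flat k (f p)) differentiable (at p)" for p
    unfolding differentiable_def by blast
  moreover have "partial_deriv i (\<lambda>p. flat k (f p)) =
      (\<lambda>p. (flat (Suc (Suc k)) (f p) + (- real k) * flat (Suc k) (f p)) * partial_deriv i f p)"
    by (rule ext) (simp add: partial_deriv_eqI[OF d], simp add: partial_deriv_def)
  moreover have "smooth_expr \<dots>"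
    using flat by (intro smooth_expr.mult smooth_expr.add smooth_expr.const smooth_expr.flat) auto
  ultimately show ?case by (simp only:)
qed

lemma smooth_expr_Ck_on: "smooth_expr f \<Longrightarrow> Ck_on k f S"
proof (induction k arbitrary: f)
  case 0
  then show ?case
    using smooth_expr_partial_deriv
    by (auto intro!: continuous_at_imp_continuous_on differentiable_imp_continuous_within)
next
  case (Suc k)
  then show ?case using smooth_expr_partial_deriv by auto
qed

lemma smooth_expr_sum:
  "finite A \<Longrightarrow> (\<And>i. i \<in> A \<Longrightarrow> smooth_expr (f i)) \<Longrightarrow> smooth_expr (\<lambda>p. \<Sum>i\<in>A. f i p)"
  by (induction A rule: finite_induct) (auto intro: smooth_expr.const smooth_expr.add)

text \<open>The squared distance makes the argument of \<open>flat 0\<close> a polynomial in the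
  coordinates, hence a \<open>smooth_expr\<close>; as \<open>flat 0\<close> is positive exactly for
  positive arguments, the support for \<open>r > 0\<close> is the closed ball.\<close>

definition bump :: "real^'n::finite \<Rightarrow> real \<Rightarrow> real^'n \<Rightarrow> real" where
  "bump c r p = flat 0 (r\<^sup>2 - (dist p c)\<^sup>2)"

lemma smooth_expr_bump: "smooth_expr (bump c r)"
proof -
  have "bump c r = (\<lambda>p. flat 0 (r\<^sup>2 + (-1) * (\<Sum>i\<in>UNIV. (p $ i + - (c $ i)) * (p $ i + - (c $ i)))))"
    by (rule ext) (simp add: bump_def dist_norm power2_norm_eq_inner inner_vec_def)
  moreover have "smooth_expr (\<lambda>p. flat 0 (r\<^sup>2 + (-1) * (\<Sum>i\<in>UNIV. (p $ i + - (c $ i)) * (p $ i + - (c $ i)))))"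
    by (intro smooth_expr.flat smooth_expr.add smooth_expr.mult smooth_expr.const smooth_expr.coord
        smooth_expr_sum finite)
  ultimately show ?thesis by (simp only:)
qed

lemma bump_nonneg: "0 \<le> bump c r p"
  by (simp add: bump_def flat_def)

lemma bump_pos_iff:
  assumes "r > 0"
  shows "0 < bump c r p \<longleftrightarrow> p \<in> ball c r"
proof -
  have "(dist p c)\<^sup>2 < r\<^sup>2 \<longleftrightarrow> dist p c < r"
    using assms power_strict_mono[of "dist p c" r 2] power2_less_imp_less[of "dist p c" r] by auto
  then show ?thesis by (auto simp: bump_def flat_def not_le dist_commute)
qed

lemma bump_eq_0_iff:
  assumes "r > 0"
  shows "bump c r p = 0 \<longleftrightarrow> p \<notin> ball c r"
  using bump_pos_iff[OF assms, of c p] bump_nonneg[of c r p] by linarith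

lemma test_function_bump:
  assumes "r > 0" "cball c r \<subseteq> \<Omega>"
  shows "test_function \<Omega> (bump c r)"
proof -
  have "{p. bump c r p \<noteq> 0} = ball c r"
    by (simp only: bump_eq_0_iff[OF assms(1)] not_not Collect_mem_eq)
  then show ?thesis
    using assms smooth_expr_Ck_on[OF smooth_expr_bump[of c r]] by (simp add: test_function_def closure_ball)
qed

section \<open>Integration against bump functions\<close>

lemma integrable_compact_support:
  fixes h :: "'a::euclidean_space \<Rightarrow> real"
  assumes "continuous_on UNIV h" "\<And>p. p \<notin> cball c r \<Longrightarrow> h p = 0"
  shows "integrable lborel h"
proof -
  have "integrable lborel (\<lambda>p. indicator (cball c r) p *\<^sub>R h p)"
    using borel_integrable_compact[OF compact_cball, of c r h] continuous_on_subset[OF assms(1)]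
    by (auto simp: set_integrable_def)
  also have "(\<lambda>p. indicator (cball c r) p *\<^sub>R h p) = h"
    using assms(2) by (auto simp: indicator_def fun_eq_iff)
  finally show ?thesis .
qed

lemma integral_lborel_shift:
  fixes h :: "'a::euclidean_space \<Rightarrow> real"
  assumes "h \<in> borel_measurable borel"
  shows "(LINT p|lborel. h (v + p)) = (LINT p|lborel. h p)"
proof -
  have "(LINT p|lborel. h p) = (LINT p|distr lborel borel ((+) v). h p)"
    by (simp add: lborel_distr_plus)
  also have "\<dots> = (LINT p|lborel. h (v + p))"
    by (rule integral_distr) (use assms in auto)
  finally show ?thesis by simp
qed

text \<open>By translation invariance of Lebesgue measure every difference quotient of
  \<open>h\<close> has integral 0; dominated convergence passes this to the derivative, with no
  iterated integrals.\<close>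

lemma integral_partial_deriv_eq_0:
  fixes h :: "real^'n::finite \<Rightarrow> real"
  assumes h: "\<And>p. h differentiable (at p)"
    and cont: "continuous_on UNIV (partial_deriv i h)"
    and supp: "\<And>p. p \<notin> cball c r \<Longrightarrow> h p = 0"
  shows "(LINT p|lborel. partial_deriv i h p) = 0"
proof -
  let ?e = "axis i 1 :: real^'n"
  \<comment> \<open>Steps of length at most 1: the quotients then vanish outside
    \<open>cball c (r + 1)\<close>, and the mean value points used to bound them stay in
    \<open>cball c (r + 2)\<close>, where the derivative is bounded by \<open>B\<close>.\<close>
  define t where "t n = 1 / real (Suc n)" for n
  have t: "0 < t n" "t n \<le> 1" for n by (auto simp: t_def)
  define s where "s n p = (h (t n *\<^sub>R ?e + p) - h p) / t n" for n p
  have h_cont: "continuous_on UNIV h"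
    using h by (intro continuous_at_imp_continuous_on ballI differentiable_imp_continuous_within)
  then have h_meas: "h \<in> borel_measurable borel" by (rule borel_measurable_continuous_onI)
  have h_int: "integrable lborel h" by (rule integrable_compact_support[OF h_cont supp])
  have h_int': "integrable lborel (\<lambda>p. h (v + p))" for v
  proof (rule integrable_compact_support)
    show "continuous_on UNIV (\<lambda>p. h (v + p))"
      by (intro continuous_on_compose2[OF h_cont] continuous_intros) auto
    show "h (v + p) = 0" if "p \<notin> cball (c - v) r" for p
      using that by (intro supp) (simp add: dist_norm algebra_simps)
  qed
  have s0: "(LINT p|lborel. s n p) = 0" for n
    unfolding s_def using h_int h_int' integral_lborel_shift[OF h_meas] by simp
  have "bounded (partial_deriv i h ` cball c (r + 2))"
    by (intro compact_imp_bounded compact_continuous_image continuous_on_subset[OF cont]) auto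
  then obtain B where B: "\<And>p. p \<in> cball c (r + 2) \<Longrightarrow> \<bar>partial_deriv i h p\<bar> \<le> B"
    unfolding bounded_iff image_iff real_norm_def by blast
  have "(\<lambda>n. LINT p|lborel. s n p) \<longlonglongrightarrow> (LINT p|lborel. partial_deriv i h p)"
  proof (rule integral_dominated_convergence[where w = "\<lambda>p. indicator (cball c (r + 1)) p *\<^sub>R B"])
    show "partial_deriv i h \<in> borel_measurable lborel"
      using borel_measurable_continuous_onI[OF cont] by simp
    show "s n \<in> borel_measurable lborel" for n
      unfolding s_def using h_int h_int' by (intro borel_measurable_integrable) simp
    show "integrable lborel (\<lambda>p. indicator (cball c (r + 1)) p *\<^sub>R B)"
      using borel_integrable_compact[OF compact_cball, of c "r + 1" "\<lambda>_. B"] by (simp add: set_integrable_def)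
    show "AE p in lborel. (\<lambda>n. s n p) \<longlonglongrightarrow> partial_deriv i h p"
    proof (rule AE_I2)
      fix p :: "real^'n"
      have "((\<lambda>x. (h (p + x *\<^sub>R ?e) - h p) / x) \<longlongrightarrow> partial_deriv i h p) (at 0)"
        using has_real_derivative_along_axis[of h p 0 i] h by (simp add: DERIV_def)
      moreover have "filterlim t (at 0) sequentially"
        unfolding filterlim_at t_def using LIMSEQ_inverse_real_of_nat by (simp add: field_simps)
      ultimately show "(\<lambda>n. s n p) \<longlonglongrightarrow> partial_deriv i h p"
        unfolding s_def by (subst add.commute) (rule filterlim_compose)
    qed
    show "AE p in lborel. norm (s n p) \<le> indicator (cball c (r + 1)) p *\<^sub>R B" for n
    proof (rule AE_I2)
      fix p :: "real^'n"
      have near: "dist c (p + x *\<^sub>R ?e) \<le> dist c p + 1" "dist c p \<le> dist c (p + x *\<^sub>R ?e) + 1"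
        if "0 \<le> x" "x \<le> 1" for x
      proof -
        have "dist p (p + x *\<^sub>R ?e) \<le> 1" using that by (simp add: dist_norm)
        then show "dist c (p + x *\<^sub>R ?e) \<le> dist c p + 1" "dist c p \<le> dist c (p + x *\<^sub>R ?e) + 1"
          using dist_triangle[of c "p + x *\<^sub>R ?e" p] dist_triangle[of c p "p + x *\<^sub>R ?e"]
          by (auto simp: dist_commute)
      qed
      show "norm (s n p) \<le> indicator (cball c (r + 1)) p *\<^sub>R B"
      proof (cases "p \<in> cball c (r + 1)")
        case True
        have "\<exists>z>0. z < t n \<and> h (p + t n *\<^sub>R ?e) - h (p + 0 *\<^sub>R ?e)
            = (t n - 0) * partial_deriv i h (p + z *\<^sub>R ?e)"
          by (rule MVT2[OF t(1)]) (rule has_real_derivative_along_axis[OF h])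
        then obtain z where z: "0 < z" "z < t n"
          "h (p + t n *\<^sub>R ?e) - h (p + 0 *\<^sub>R ?e) = (t n - 0) * partial_deriv i h (p + z *\<^sub>R ?e)"
          by blast
        then have "s n p = partial_deriv i h (p + z *\<^sub>R ?e)"
          using t(1)[of n] by (simp add: s_def add.commute)
        moreover have "p + z *\<^sub>R ?e \<in> cball c (r + 2)"
          using near(1)[of z] z t(2)[of n] True by simp
        ultimately show ?thesis using B True by simp
      next
        case False
        then have "h p = 0" by (intro supp) simp
        moreover have "h (t n *\<^sub>R ?e + p) = 0"
          using near(2)[of "t n"] t[of n] False by (intro supp) (simp add: add.commute)
        ultimately show ?thesis using False by (simp add: s_def)
      qed
    qed
  qed
  then show ?thesis by (simp add: s0 tendsto_const_iff)
qed

text \<open>If \<open>D c\<close> were positive, \<open>D\<close> would be positive on a small ball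
  about \<open>c\<close> and the integrand nonnegative; a zero integral then makes the ball a null
  set. The other sign comes from \<open>- D\<close>.\<close>

lemma bump_orthogonal_imp_nonpos:
  fixes D :: "real^'n::finite \<Rightarrow> real"
  assumes "open \<Omega>" "continuous_on \<Omega> D" "c \<in> \<Omega>"
    and orth: "\<And>r. r > 0 \<Longrightarrow> cball c r \<subseteq> \<Omega> \<Longrightarrow> (LINT p|lborel. D p * bump c r p) = 0"
  shows "D c \<le> 0"
proof (rule ccontr)
  assume "\<not> D c \<le> 0"
  have "open {p \<in> \<Omega>. D p > 0}"
    using continuous_open_preimage[OF assms(2,1) open_greaterThan[of 0]]
    by (simp add: vimage_def Int_def)
  moreover have "c \<in> {p \<in> \<Omega>. D p > 0}"
    using \<open>\<not> D c \<le> 0\<close> \<open>c \<in> \<Omega>\<close> by simp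
  ultimately obtain r where r: "r > 0" "cball c r \<subseteq> {p \<in> \<Omega>. D p > 0}"
    unfolding open_contains_cball by blast
  then have sub: "cball c r \<subseteq> \<Omega>" by blast
  let ?g = "\<lambda>p. D p * bump c r p"
  have bump_cont: "continuous_on S (bump c r)" for S
    using smooth_expr_Ck_on[OF smooth_expr_bump, of 0] by simp
  have "integrable lborel (\<lambda>p. indicator (cball c r) p *\<^sub>R ?g p)"
    using borel_integrable_compact[OF compact_cball, of c r ?g]
      continuous_on_mult[OF continuous_on_subset[OF assms(2) sub] bump_cont]
    by (simp add: set_integrable_def)
  also have "(\<lambda>p. indicator (cball c r) p *\<^sub>R ?g p) = ?g"
    by (rule ext) (use bump_eq_0_iff[OF r(1), of c] in \<open>auto simp: indicator_def\<close>)
  finally have int: "integrable lborel ?g" .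
  have nonneg: "0 \<le> ?g p" for p
  proof (cases "p \<in> cball c r")
    case True
    then show ?thesis using r(2) bump_nonneg[of c r p] by fastforce
  next
    case False
    then show ?thesis using bump_eq_0_iff[OF r(1), of c p] by simp
  qed
  have "AE p in lborel. ?g p = 0"
    using orth[OF r(1) sub] integral_nonneg_eq_0_iff_AE[OF int] nonneg by simp
  then have "AE p in lborel. p \<notin> ball c r"
  proof eventually_elim
    case (elim p)
    show ?case
    proof
      assume "p \<in> ball c r"
      then have "D p > 0" "bump c r p > 0"
        using subsetD[OF r(2), of p] bump_pos_iff[OF r(1), of c p] by auto
      then show False using elim by simp
    qed
  qed
  then have "ball c r \<in> null_sets lborel"
    by (subst (asm) AE_iff_null) (auto simp: ball_def)
  then have "negligible (ball c r)"
    by (simp add: negligible_iff_null_sets null_sets_completionI)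
  then show False using open_not_negligible[OF open_ball[of c r]] r(1) by simp
qed

lemma bump_orthogonal_imp_0:
  fixes D :: "real^'n::finite \<Rightarrow> real"
  assumes "open \<Omega>" "continuous_on \<Omega> D" "c \<in> \<Omega>"
    and orth: "\<And>r. r > 0 \<Longrightarrow> cball c r \<subseteq> \<Omega> \<Longrightarrow> (LINT p|lborel. D p * bump c r p) = 0"
  shows "D c = 0"
proof (rule antisym)
  show "D c \<le> 0" using assms by (rule bump_orthogonal_imp_nonpos)
  have "- D c \<le> 0"
    by (rule bump_orthogonal_imp_nonpos[OF assms(1) continuous_on_minus[OF assms(2)] assms(3)])
      (use orth in simp)
  then show "0 \<le> D c" by simp
qed

text \<open>Integration by parts for a field that is controlled on \<open>\<Omega>\<close> only. Its
  product with the bump, extended by 0, is differentiable on the whole space, so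
  \<open>integral_partial_deriv_eq_0\<close> applies to each component.\<close>

lemma weak_divergence_bump:
  fixes V :: "'n::finite \<Rightarrow> real^'n \<Rightarrow> real"
  assumes "open \<Omega>" "r > 0" "cball c r \<subseteq> \<Omega>"
    and V: "\<And>i p. p \<in> \<Omega> \<Longrightarrow> V i differentiable (at p)"
    and divV: "\<And>i. continuous_on \<Omega> (partial_deriv i (V i))"
    and weak: "(LINT p:\<Omega>|lborel. \<Sum>i\<in>UNIV. V i p * partial_deriv i (bump c r) p) = 0"
  shows "(LINT p|lborel. (\<Sum>i\<in>UNIV. partial_deriv i (V i) p) * bump c r p) = 0"
proof -
  let ?\<phi> = "bump c r"
  have \<phi>: "?\<phi> differentiable (at p)" "continuous_on S ?\<phi>" "continuous_on S (partial_deriv i ?\<phi>)" for p i S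
    using smooth_expr_partial_deriv[OF smooth_expr_bump[of c r]] smooth_expr_Ck_on[OF smooth_expr_bump[of c r], of 1 S]
      smooth_expr_Ck_on[OF smooth_expr_bump[of c r], of 0 S]
    by auto
  have \<phi>0: "?\<phi> p = 0" if "p \<notin> cball c r" for p
    using that bump_eq_0_iff[OF \<open>r > 0\<close>, of c p] ball_subset_cball by blast
  \<comment> \<open>\<open>\<Omega>\<close> and the complement of \<open>cball c r\<close> are open
    and cover the space; \<open>h i\<close> is the product on one and 0 on the other, so
    differentiability and continuity may be checked on each separately.\<close>
  define h where "h i p = (if p \<in> \<Omega> then V i p * ?\<phi> p else 0)" for i p
  have h0: "h i p = 0" if "p \<in> - cball c r" for i p
    using that \<phi>0[of p] by (simp add: h_def)
  have h1: "h i p = V i p * ?\<phi> p" if "p \<in> \<Omega>" for i p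
    using that by (simp add: h_def)
  have cover: "\<Omega> \<union> - cball c r = UNIV" using assms(3) by blast
  have opens: "open \<Omega>" "open (- cball c r)" using \<open>open \<Omega>\<close> by auto
  have V\<phi>: "(\<lambda>p. V i p * ?\<phi> p) differentiable (at p)" if "p \<in> \<Omega>" for i p
    using V[OF that] \<phi>(1) by (rule differentiable_mult)
  have hdiff: "h i differentiable (at p)" for i p
  proof (cases "p \<in> \<Omega>")
    case True
    have "V i q * ?\<phi> q = h i q" if "q \<in> \<Omega>" for q using h1[OF that] by simp
    from differentiable_cong_open[OF opens(1) True this V\<phi>[OF True]] show ?thesis .
  next
    case False
    then have "p \<in> - cball c r" using cover by blast
    moreover have "0 = h i q" if "q \<in> - cball c r" for q using h0[OF that] by simp
    ultimately show ?thesis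
      using differentiable_cong_open[of "- cball c r" p "\<lambda>_. 0" "h i"] opens(2) by simp
  qed
  have dh1: "partial_deriv i (h i) p = V i p * partial_deriv i ?\<phi> p + partial_deriv i (V i) p * ?\<phi> p"
    if "p \<in> \<Omega>" for i p
    using partial_deriv_cong[OF opens(1) that h1 hdiff] partial_deriv_mult[OF V[OF that] \<phi>(1)] by simp
  have dh0: "partial_deriv i (h i) p = 0" if "p \<in> - cball c r" for i p
    using partial_deriv_cong[OF opens(2) that h0 hdiff] by (simp add: partial_deriv_const)
  have Vcont: "continuous_on \<Omega> (V i)" for i
    using V by (intro continuous_at_imp_continuous_on ballI differentiable_imp_continuous_within)
  have dhcont: "continuous_on UNIV (partial_deriv i (h i))" for i
  proof -
    have "continuous_on \<Omega> (\<lambda>p. V i p * partial_deriv i ?\<phi> p + partial_deriv i (V i) p * ?\<phi> p)"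
      by (intro continuous_intros Vcont divV \<phi>)
    then have "continuous_on \<Omega> (partial_deriv i (h i))"
      by (rule continuous_on_eq) (simp add: dh1)
    moreover have "continuous_on (- cball c r) (partial_deriv i (h i))"
      by (rule continuous_on_eq[OF continuous_on_const]) (rule dh0[symmetric])
    ultimately show ?thesis
      using continuous_on_open_Un[OF opens] by (simp add: cover)
  qed
  have int_dh: "(LINT p|lborel. partial_deriv i (h i) p) = 0" for i
    by (rule integral_partial_deriv_eq_0[OF hdiff dhcont, of c r]) (use h0 in simp)
  have dh_integrable: "integrable lborel (partial_deriv i (h i))" for i
    by (rule integrable_compact_support[OF dhcont, of c r]) (use dh0 in simp)
  let ?k = "\<lambda>p. (\<Sum>i\<in>UNIV. partial_deriv i (V i) p) * ?\<phi> p"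
  have k_integrable: "integrable lborel ?k"
  proof -
    have "continuous_on (cball c r) ?k"
      by (intro continuous_intros \<phi> continuous_on_subset[OF divV assms(3)])
    then have "integrable lborel (\<lambda>p. indicator (cball c r) p *\<^sub>R ?k p)"
      using borel_integrable_compact[OF compact_cball, of c r ?k] by (simp add: set_integrable_def)
    moreover have "(\<lambda>p. indicator (cball c r) p *\<^sub>R ?k p) = ?k"
      by (rule ext) (use \<phi>0 in \<open>auto simp: indicator_def\<close>)
    ultimately show ?thesis by (simp only:)
  qed
  have "0 = (LINT p:\<Omega>|lborel. \<Sum>i\<in>UNIV. V i p * partial_deriv i ?\<phi> p)"
    using weak by simp
  \<comment> \<open>The product rule on \<open>\<Omega>\<close>; off \<open>\<Omega>\<close> all
    terms vanish, since the support of the bump lies inside \<open>\<Omega>\<close>.\<close>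
  also have "\<dots> = (LINT p|lborel. (\<Sum>i\<in>UNIV. partial_deriv i (h i) p) - ?k p)"
    unfolding set_lebesgue_integral_def
  proof (rule Bochner_Integration.integral_cong[OF refl])
    fix p :: "real^'n"
    show "indicator \<Omega> p *\<^sub>R (\<Sum>i\<in>UNIV. V i p * partial_deriv i ?\<phi> p) = (\<Sum>i\<in>UNIV. partial_deriv i (h i) p) - ?k p"
    proof (cases "p \<in> \<Omega>")
      case True
      then show ?thesis by (simp add: dh1 sum.distrib sum_distrib_right)
    next
      case False
      then have p: "p \<in> - cball c r" using cover by blast
      then show ?thesis using False \<phi>0[of p] by (simp add: dh0)
    qed
  qed
  also have "\<dots> = (\<Sum>i\<in>UNIV. (LINT p|lborel. partial_deriv i (h i) p)) - (LINT p|lborel. ?k p)"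
    using dh_integrable k_integrable
    by (subst Bochner_Integration.integral_diff) (auto intro!: Bochner_Integration.integral_sum)
  finally show ?thesis by (simp add: int_dh)
qed

section \<open>The stress tensor\<close>

text \<open>The tensor whose divergence in \<open>\<beta>\<close> vanishes weakly by criticality, for \<open>a = 1 + (H' \<circ> y)\<^sup>2\<close>.\<close>

definition stress :: "(real^'n::finite \<Rightarrow> real) \<Rightarrow> (real^'n \<Rightarrow> real) \<Rightarrow> 'n \<Rightarrow> 'n \<Rightarrow> real^'n \<Rightarrow> real" where
  "stress a y \<gamma> \<beta> p =
     a p * ((if \<beta> = \<gamma> then (\<Sum>k\<in>UNIV. partial_deriv k y p * partial_deriv k y p) else 0)
            - 2 * (partial_deriv \<beta> y p * partial_deriv \<gamma> y p))"

lemma partial_deriv_stress: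
  fixes y :: "real^'n::finite \<Rightarrow> real"
  assumes "open S" "p \<in> S" and y: "Ck_on 2 y S"
    and a: "a differentiable (at p)"
  shows "stress a y \<gamma> \<beta> differentiable (at p)"
    and "partial_deriv \<beta> (stress a y \<gamma> \<beta>) p =
      a p * ((if \<beta> = \<gamma> then 2 * (\<Sum>k\<in>UNIV. partial_deriv k y p * partial_deriv \<beta> (partial_deriv k y) p) else 0)
             - 2 * (partial_deriv \<beta> y p * partial_deriv \<beta> (partial_deriv \<gamma> y) p
                    + partial_deriv \<beta> (partial_deriv \<beta> y) p * partial_deriv \<gamma> y p))
      + partial_deriv \<beta> a p * ((if \<beta> = \<gamma> then (\<Sum>k\<in>UNIV. partial_deriv k y p * partial_deriv k y p) else 0)
            - 2 * (partial_deriv \<beta> y p * partial_deriv \<gamma> y p))"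
proof -
  have yi: "partial_deriv i y differentiable (at p)" for i
    using y assms(2) by (simp add: numeral_2_eq_2)
  have sq: "(\<lambda>p. \<Sum>k\<in>UNIV. partial_deriv k y p * partial_deriv k y p) differentiable (at p)"
    by (intro differentiable_sum differentiable_mult yi finite ballI)
  let ?B = "\<lambda>p. (if \<beta> = \<gamma> then (\<Sum>k\<in>UNIV. partial_deriv k y p * partial_deriv k y p) else 0)
            - 2 * (partial_deriv \<beta> y p * partial_deriv \<gamma> y p)"
  have cross: "(\<lambda>p. 2 * (partial_deriv \<beta> y p * partial_deriv \<gamma> y p)) differentiable (at p)"
    using yi by simp
  have if_diff: "(\<lambda>p. (if \<beta> = \<gamma> then (\<Sum>k\<in>UNIV. partial_deriv k y p * partial_deriv k y p) else 0)) differentiable (at p)"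
    using sq by (cases "\<beta> = \<gamma>") simp_all
  have B: "?B differentiable (at p)"
    using if_diff cross by (rule differentiable_diff)
  have "partial_deriv \<beta> (\<lambda>p. (if \<beta> = \<gamma> then (\<Sum>k\<in>UNIV. partial_deriv k y p * partial_deriv k y p) else 0)) p
      = (if \<beta> = \<gamma> then 2 * (\<Sum>k\<in>UNIV. partial_deriv k y p * partial_deriv \<beta> (partial_deriv k y) p) else 0)"
    using yi by (auto simp: partial_deriv_const partial_deriv_sum partial_deriv_mult sum_distrib_left mult.commute
        intro!: sum.cong)
  moreover have "partial_deriv \<beta> (\<lambda>p. 2 * (partial_deriv \<beta> y p * partial_deriv \<gamma> y p)) p
      = 2 * (partial_deriv \<beta> y p * partial_deriv \<beta> (partial_deriv \<gamma> y) p
                    + partial_deriv \<beta> (partial_deriv \<beta> y) p * partial_deriv \<gamma> y p)"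
    using yi by (simp add: partial_deriv_cmult partial_deriv_mult)
  ultimately have dB: "partial_deriv \<beta> ?B p =
      (if \<beta> = \<gamma> then 2 * (\<Sum>k\<in>UNIV. partial_deriv k y p * partial_deriv \<beta> (partial_deriv k y) p) else 0)
             - 2 * (partial_deriv \<beta> y p * partial_deriv \<beta> (partial_deriv \<gamma> y) p
                    + partial_deriv \<beta> (partial_deriv \<beta> y) p * partial_deriv \<gamma> y p)"
    using partial_deriv_diff[OF if_diff cross, of \<beta>] by simp
  show "stress a y \<gamma> \<beta> differentiable (at p)"
    unfolding stress_def[abs_def] using a B by (rule differentiable_mult)
  show "partial_deriv \<beta> (stress a y \<gamma> \<beta>) p =
      a p * ((if \<beta> = \<gamma> then 2 * (\<Sum>k\<in>UNIV. partial_deriv k y p * partial_deriv \<beta> (partial_deriv k y) p) else 0)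
             - 2 * (partial_deriv \<beta> y p * partial_deriv \<beta> (partial_deriv \<gamma> y) p
                    + partial_deriv \<beta> (partial_deriv \<beta> y) p * partial_deriv \<gamma> y p))
      + partial_deriv \<beta> a p * ((if \<beta> = \<gamma> then (\<Sum>k\<in>UNIV. partial_deriv k y p * partial_deriv k y p) else 0)
            - 2 * (partial_deriv \<beta> y p * partial_deriv \<gamma> y p))"
    unfolding stress_def[abs_def] partial_deriv_mult[OF a B] dB ..
qed

text \<open>By symmetry of second derivatives, the \<open>\<gamma>\<close>-derivative of
  \<open>|grad y|^2\<close> cancels the mixed terms of the product, leaving \<open>- 2 * a\<close>
  times the Laplacian times \<open>partial_deriv \<gamma> y\<close>. Since the gradient of
  \<open>a\<close> is parallel to that of \<open>y\<close>, its two contributions combine as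
  \<open>b - 2 * b = - b\<close>, and \<open>partial_deriv \<gamma> y\<close> factors out of
  everything.\<close>

lemma divergence_stress:
  fixes y :: "real^'n::finite \<Rightarrow> real"
  assumes "open S" "p \<in> S" and y: "Ck_on 2 y S"
    and a: "a differentiable (at p)" and da: "\<And>i. partial_deriv i a p = b * partial_deriv i y p"
  shows "(\<Sum>\<beta>\<in>UNIV. partial_deriv \<beta> (stress a y \<gamma> \<beta>) p) =
    - partial_deriv \<gamma> y p * (b * (\<Sum>k\<in>UNIV. (partial_deriv k y p)\<^sup>2) + 2 * a p * laplacian y p)"
proof -
  let ?d = "\<lambda>i. partial_deriv i y p" and ?h = "\<lambda>i j. partial_deriv i (partial_deriv j y) p"
  have sym: "?h i j = ?h j i" for i j
    by (rule partial_deriv_commute[OF assms(1,2)]) (use y in \<open>auto simp: numeral_2_eq_2\<close>)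
  have "(\<Sum>\<beta>\<in>UNIV. partial_deriv \<beta> (stress a y \<gamma> \<beta>) p) =
    (\<Sum>\<beta>\<in>UNIV. (if \<beta> = \<gamma> then 2 * a p * (\<Sum>k\<in>UNIV. ?d k * ?h \<beta> k) else 0)
       + (if \<beta> = \<gamma> then b * ?d \<beta> * (\<Sum>k\<in>UNIV. ?d k * ?d k) else 0)
       - 2 * a p * (?d \<beta> * ?h \<beta> \<gamma>) - 2 * a p * ?d \<gamma> * ?h \<beta> \<beta>
       - 2 * b * ?d \<gamma> * (?d \<beta> * ?d \<beta>))"
    by (rule sum.cong[OF refl])
      (simp add: partial_deriv_stress(2)[OF assms(1-3) a] da algebra_simps)
  also have "\<dots> = 2 * a p * (\<Sum>k\<in>UNIV. ?d k * ?h \<gamma> k) + b * ?d \<gamma> * (\<Sum>k\<in>UNIV. ?d k * ?d k)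
      - 2 * a p * (\<Sum>k\<in>UNIV. ?d k * ?h k \<gamma>) - 2 * a p * ?d \<gamma> * laplacian y p
      - 2 * b * ?d \<gamma> * (\<Sum>k\<in>UNIV. ?d k * ?d k)"
    by (simp add: sum.distrib sum_subtractf sum_distrib_left laplacian_def)
  also have "(\<Sum>k\<in>UNIV. ?d k * ?h k \<gamma>) = (\<Sum>k\<in>UNIV. ?d k * ?h \<gamma> k)"
    using sym by simp
  finally show ?thesis by (simp add: power2_eq_square algebra_simps)
qed

text \<open>Since \<open>x\<close> is a function of \<open>y\<close>, each sum of products of
  derivatives in the first variation collapses to \<open>1 + H'^2\<close> times a product of
  derivatives of \<open>y\<close>. The integrand is thus row \<open>\<gamma>\<close> of
  \<open>stress\<close> paired with the gradient of the test function.\<close>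

lemma domain_critical_imp_laplacian_eq:
  fixes f :: "real^'n::finite \<Rightarrow> heisenberg"
  assumes "open \<Omega>" and f: "Ck_on 2 f \<Omega>" and crit: "domain_critical \<Omega> f"
    and H: "C2_on_interval I H H' H''" and I: "y_comp f ` \<Omega> \<subseteq> I"
    and x: "\<forall>p\<in>\<Omega>. x_comp f p = H (y_comp f p)"
    and c: "c \<in> \<Omega>"
  shows "partial_deriv \<gamma> (y_comp f) c *
    (H'' (y_comp f c) * H' (y_comp f c) * (\<Sum>k\<in>UNIV. (partial_deriv k (y_comp f) c)\<^sup>2)
     + (1 + (H' (y_comp f c))\<^sup>2) * laplacian (y_comp f) c) = 0"
proof -
  define y where "y = y_comp f"
  define a where "a p = 1 + (H' (y p))\<^sup>2" for p
  \<comment> \<open>The coefficient that expresses the gradient of \<open>a\<close> through that of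
    \<open>y\<close>, as \<open>divergence_stress\<close> expects.\<close>
  define b where "b p = 2 * (H'' (y p) * H' (y p))" for p
  define W where "W p = (\<Sum>k\<in>UNIV. (partial_deriv k y p)\<^sup>2)" for p
  have yC2: "Ck_on 2 y \<Omega>" unfolding y_def by (rule Ck_on_component[OF \<open>open \<Omega>\<close> f])
  then have y: "y differentiable (at p)" and yi: "partial_deriv i y differentiable (at p)"
    and yij: "continuous_on \<Omega> (partial_deriv j (partial_deriv i y))" if "p \<in> \<Omega>" for p i j
    using that by (auto simp: numeral_2_eq_2)
  have ycont: "continuous_on \<Omega> y" "continuous_on \<Omega> (partial_deriv i y)" for i
    using y yi by (auto intro!: continuous_at_imp_continuous_on differentiable_imp_continuous_within)
  have yI: "y ` \<Omega> \<subseteq> I" using I by (simp add: y_def)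
  have dH: "(H has_real_derivative H' u) (at u within I)" "(H' has_real_derivative H'' u) (at u within I)"
    if "u \<in> I" for u using H that by (auto simp: C2_on_interval_def)
  have H'cont: "continuous_on \<Omega> (\<lambda>p. H' (y p))"
    by (rule continuous_on_compose2[OF _ ycont(1) yI])
      (use dH(2) in \<open>auto intro!: DERIV_continuous simp: continuous_on_eq_continuous_within\<close>)
  have H''cont: "continuous_on \<Omega> (\<lambda>p. H'' (y p))"
    by (rule continuous_on_compose2[OF _ ycont(1) yI]) (use H in \<open>simp add: C2_on_interval_def\<close>)
  have chain: "(\<lambda>q. H' (y q)) differentiable (at p)"
      "partial_deriv i (\<lambda>q. H' (y q)) p = H'' (y p) * partial_deriv i y p"
      "partial_deriv i (\<lambda>q. H (y q)) p = H' (y p) * partial_deriv i y p"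
      "(\<lambda>q. H (y q)) differentiable (at p)" if "p \<in> \<Omega>" for p i
  proof -
    have u: "y p \<in> I" using that yI by blast
    note pc = partial_deriv_chain_within[OF \<open>open \<Omega>\<close> that yI y[OF that]]
    show "(\<lambda>q. H' (y q)) differentiable (at p)"
      "partial_deriv i (\<lambda>q. H' (y q)) p = H'' (y p) * partial_deriv i y p"
      "partial_deriv i (\<lambda>q. H (y q)) p = H' (y p) * partial_deriv i y p"
      "(\<lambda>q. H (y q)) differentiable (at p)"
      using pc[OF dH(1)[OF u]] pc[OF dH(2)[OF u]] by blast+
  qed
  have xi: "partial_deriv i (x_comp f) p = H' (y p) * partial_deriv i y p" if p: "p \<in> \<Omega>" for p i
  proof -
    have "H (y q) = x_comp f q" if "q \<in> \<Omega>" for q using x that by (simp add: y_def)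
    from partial_deriv_cong[OF \<open>open \<Omega>\<close> p this chain(4)[OF p], of i] show ?thesis
      using chain(3)[OF p] by simp
  qed
  have a: "a differentiable (at p)" "partial_deriv i a p = b p * partial_deriv i y p" if "p \<in> \<Omega>" for p i
  proof -
    note c = chain(1,2)[OF that]
    have "(\<lambda>q. H' (y q) * H' (y q)) differentiable (at p)" using c(1) c(1) by (rule differentiable_mult)
    then show "a differentiable (at p)" "partial_deriv i a p = b p * partial_deriv i y p"
      unfolding a_def[abs_def] power2_eq_square
      by (simp_all add: partial_deriv_add partial_deriv_mult partial_deriv_const c b_def)
  qed
  note st = partial_deriv_stress[OF \<open>open \<Omega>\<close> _ yC2 a(1)]
  have div: "(\<Sum>\<beta>\<in>UNIV. partial_deriv \<beta> (stress a y \<gamma> \<beta>) p)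
      = - partial_deriv \<gamma> y p * (b p * W p + 2 * a p * laplacian y p)" if "p \<in> \<Omega>" for p
    using divergence_stress[OF \<open>open \<Omega>\<close> that yC2 a[OF that]] by (simp add: W_def)
  have acont: "continuous_on \<Omega> a" "continuous_on \<Omega> b"
    unfolding a_def[abs_def] b_def[abs_def] by (intro continuous_intros H'cont H''cont)+
  have divcont: "continuous_on \<Omega> (partial_deriv \<beta> (stress a y \<gamma> \<beta>))" for \<beta>
  proof (rule continuous_on_eq)
    show "continuous_on \<Omega> (\<lambda>p. a p * ((if \<beta> = \<gamma> then 2 * (\<Sum>k\<in>UNIV. partial_deriv k y p * partial_deriv \<beta> (partial_deriv k y) p) else 0)
             - 2 * (partial_deriv \<beta> y p * partial_deriv \<beta> (partial_deriv \<gamma> y) p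
                    + partial_deriv \<beta> (partial_deriv \<beta> y) p * partial_deriv \<gamma> y p))
      + (b p * partial_deriv \<beta> y p) * ((if \<beta> = \<gamma> then (\<Sum>k\<in>UNIV. partial_deriv k y p * partial_deriv k y p) else 0)
            - 2 * (partial_deriv \<beta> y p * partial_deriv \<gamma> y p)))"
      using yij[OF c] by (cases "\<beta> = \<gamma>") (auto intro!: continuous_intros acont ycont)
  qed (simp only: st(2) a(2))
  \<comment> \<open>The divergence of row \<open>\<gamma>\<close> in closed form; its continuity on
    \<open>\<Omega>\<close> lets integral identities on shrinking balls be evaluated at the point
    \<open>c\<close>.\<close>
  let ?D = "\<lambda>p. - partial_deriv \<gamma> y p * (b p * W p + 2 * a p * laplacian y p)"
  have Dcont: "continuous_on \<Omega> ?D"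
    unfolding W_def laplacian_def using yij[OF c] by (intro continuous_intros acont ycont) auto
  have "?D c = 0"
  proof (rule bump_orthogonal_imp_0[OF \<open>open \<Omega>\<close> Dcont c])
    fix r :: real
    assume r: "r > 0" "cball c r \<subseteq> \<Omega>"
    have "(LINT p:\<Omega>|lborel. \<Sum>\<beta>\<in>UNIV. stress a y \<gamma> \<beta> p * partial_deriv \<beta> (bump c r) p)
        = (LINT p:\<Omega>|lborel.
           energy_density f p * partial_deriv \<gamma> (bump c r) p
           - 2 * (\<Sum>\<beta>\<in>UNIV.
                (partial_deriv \<beta> (x_comp f) p * partial_deriv \<gamma> (x_comp f) p
                 + partial_deriv \<beta> (y_comp f) p * partial_deriv \<gamma> (y_comp f) p)
                * partial_deriv \<beta> (bump c r) p))"
      unfolding set_lebesgue_integral_def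
    proof (rule Bochner_Integration.integral_cong[OF refl])
      fix p :: "real^'n"
      have "(\<Sum>\<beta>\<in>UNIV. stress a y \<gamma> \<beta> p * partial_deriv \<beta> (bump c r) p)
         = energy_density f p * partial_deriv \<gamma> (bump c r) p
           - 2 * (\<Sum>\<beta>\<in>UNIV.
                (partial_deriv \<beta> (x_comp f) p * partial_deriv \<gamma> (x_comp f) p
                 + partial_deriv \<beta> (y_comp f) p * partial_deriv \<gamma> (y_comp f) p)
                * partial_deriv \<beta> (bump c r) p)" if p: "p \<in> \<Omega>"
      proof -
        have "energy_density f p = a p * W p"
          unfolding energy_density_def xi[OF p] y_def[symmetric] a_def W_def
          by (simp add: power_mult_distrib sum_distrib_left[symmetric] algebra_simps)
        moreover have "(\<Sum>\<beta>\<in>UNIV. stress a y \<gamma> \<beta> p * partial_deriv \<beta> (bump c r) p)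
          = (\<Sum>\<beta>\<in>UNIV. (if \<beta> = \<gamma> then a p * W p * partial_deriv \<beta> (bump c r) p else 0)
               - 2 * (a p * (partial_deriv \<beta> y p * partial_deriv \<gamma> y p) * partial_deriv \<beta> (bump c r) p))"
          by (rule sum.cong[OF refl]) (simp add: stress_def W_def power2_eq_square algebra_simps)
        moreover have "partial_deriv \<beta> (x_comp f) p * partial_deriv \<gamma> (x_comp f) p
                 + partial_deriv \<beta> (y_comp f) p * partial_deriv \<gamma> (y_comp f) p
            = a p * (partial_deriv \<beta> y p * partial_deriv \<gamma> y p)" for \<beta>
          unfolding xi[OF p] y_def[symmetric] a_def by (simp add: power2_eq_square algebra_simps)
        ultimately show ?thesis
          by (simp add: sum_subtractf sum_distrib_left)
      qed
      then show "indicator \<Omega> p *\<^sub>R (\<Sum>\<beta>\<in>UNIV. stress a y \<gamma> \<beta> p * partial_deriv \<beta> (bump c r) p)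
        = indicator \<Omega> p *\<^sub>R (energy_density f p * partial_deriv \<gamma> (bump c r) p
           - 2 * (\<Sum>\<beta>\<in>UNIV.
                (partial_deriv \<beta> (x_comp f) p * partial_deriv \<gamma> (x_comp f) p
                 + partial_deriv \<beta> (y_comp f) p * partial_deriv \<gamma> (y_comp f) p)
                * partial_deriv \<beta> (bump c r) p))"
        by (cases "p \<in> \<Omega>") (simp_all only: indicator_simps scaleR_zero_left simp_thms)
    qed
    also have "\<dots> = 0"
      using crit test_function_bump[OF r] unfolding domain_critical_def by blast
    finally have "(LINT p|lborel. (\<Sum>\<beta>\<in>UNIV. partial_deriv \<beta> (stress a y \<gamma> \<beta>) p) * bump c r p) = 0"
      by (intro weak_divergence_bump[OF \<open>open \<Omega>\<close> r]) (use st(1) divcont in auto)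
    \<comment> \<open>The closed form \<open>div\<close> is available on \<open>\<Omega>\<close>;
      elsewhere the bump vanishes.\<close>
    also have "(LINT p|lborel. (\<Sum>\<beta>\<in>UNIV. partial_deriv \<beta> (stress a y \<gamma> \<beta>) p) * bump c r p)
        = (LINT p|lborel. ?D p * bump c r p)"
    proof (rule Bochner_Integration.integral_cong[OF refl])
      fix p :: "real^'n"
      show "(\<Sum>\<beta>\<in>UNIV. partial_deriv \<beta> (stress a y \<gamma> \<beta>) p) * bump c r p = ?D p * bump c r p"
      proof (cases "p \<in> \<Omega>")
        case True
        then show ?thesis by (simp only: div)
      next
        case False
        then have "bump c r p = 0"
          using bump_eq_0_iff[OF r(1), of c p] r(2) ball_subset_cball by blast
        then show ?thesis by simp
      qed
    qed
    finally show "(LINT p|lborel. ?D p * bump c r p) = 0" .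
  qed
  moreover have "- ?D c = 2 * (partial_deriv \<gamma> y c * (H'' (y c) * H' (y c) * W c + a c * laplacian y c))"
    by (simp add: b_def algebra_simps)
  ultimately have "partial_deriv \<gamma> y c * (H'' (y c) * H' (y c) * W c + a c * laplacian y c) = 0"
    by linarith
  then show ?thesis
    unfolding a_def W_def y_def .
qed

section \<open>Constancy of the components of a harmonic mapping\<close>

theorem proposition4p9:
  fixes \<Omega> :: "(real^'n::finite) set"
    and f :: "real^'n \<Rightarrow> heisenberg"
    and H H' H'' :: "real \<Rightarrow> real"
    and I :: "real set"
    and C :: real
    and x0 :: "real^'n"
  assumes "open \<Omega>" and "connected \<Omega>"
    and "harmonic_mapping \<Omega> f"
    and "C2_on_interval I H H' H''"
    and "y_comp f ` \<Omega> \<subseteq> I"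
    and "\<forall>p\<in>\<Omega>. x_comp f p = H (y_comp f p)"
    and "(SUP p\<in>\<Omega>. ereal \<bar>H'' (y_comp f p) * H' (y_comp f p) / (1 + (H' (y_comp f p))\<^sup>2)\<bar>)
           < ereal C"
    and "x0 \<in> \<Omega>"
    and "ereal (y_comp f x0) = (SUP p\<in>\<Omega>. ereal (y_comp f p))"
  shows "y_comp f constant_on \<Omega> \<and> x_comp f constant_on \<Omega> \<and> t_comp f constant_on \<Omega>"
proof -
  have f: "Ck_on 2 f \<Omega>" and contact: "contact_map \<Omega> f" and crit: "domain_critical \<Omega> f"
    using assms(3) by (auto simp: harmonic_mapping_def)
  have y: "Ck_on 2 (y_comp f) \<Omega>" by (rule Ck_on_component[OF assms(1) f])
  have bound: "\<bar>H'' (y_comp f p) * H' (y_comp f p) / (1 + (H' (y_comp f p))\<^sup>2)\<bar> \<le> C" if "p \<in> \<Omega>" for p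
    using le_less_trans[OF SUP_upper[OF that] assms(7)] by simp
  have max: "y_comp f p \<le> y_comp f x0" if "p \<in> \<Omega>" for p
    using SUP_upper[OF that, of "\<lambda>p. ereal (y_comp f p)"]
    by (simp only: assms(9)[symmetric] ereal_less_eq)
  have y_const: "y_comp f p = y_comp f x0" if "p \<in> \<Omega>" for p
  proof (rule strong_maximum_principle[where y = "y_comp f" and C = C, OF assms(1,2) _ _ _ max assms(8) that])
    fix p i assume p: "p \<in> \<Omega>"
    show "y_comp f differentiable (at p)" "partial_deriv i (y_comp f) differentiable (at p)"
      using y p by (auto simp: numeral_2_eq_2)
    let ?W = "\<Sum>k\<in>UNIV. (partial_deriv k (y_comp f) p)\<^sup>2"
    let ?N = "H'' (y_comp f p) * H' (y_comp f p)" and ?a = "1 + (H' (y_comp f p))\<^sup>2"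
    assume "\<exists>i. partial_deriv i (y_comp f) p \<noteq> 0"
    then have eq: "?N * ?W + ?a * laplacian (y_comp f) p = 0"
      using domain_critical_imp_laplacian_eq[OF assms(1) f crit assms(4-6) p] by auto
    have a: "?a > 0" by (simp add: add_pos_nonneg)
    have "laplacian (y_comp f) p = - (?N / ?a) * ?W"
      using eq a by (simp add: field_simps)
    also have "\<dots> \<ge> - C * ?W"
      using abs_le_D1[OF bound[OF p]] by (intro mult_right_mono sum_nonneg) simp_all
    finally show "- C * ?W \<le> laplacian (y_comp f) p" .
  qed
  have diff: "f differentiable (at p)" if "p \<in> \<Omega>" for p
    using f that by (simp add: numeral_2_eq_2)
  have x_const: "x_comp f p = H (y_comp f x0)" if "p \<in> \<Omega>" for p
    using assms(6) y_const that by simp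
  have "(t_comp f has_derivative (\<lambda>v. 0)) (at p)" if p: "p \<in> \<Omega>" for p
  proof -
    note cd = partial_deriv_component[OF diff[OF p]]
    \<comment> \<open>The first two components are constant on \<open>\<Omega>\<close> only;
      openness of \<open>\<Omega>\<close> still makes their derivatives at \<open>p\<close> vanish,
      and the contact form reduces to its \<open>dt\<close> part.\<close>
    have zero: "frechet_derivative (\<lambda>q. f q $ j) (at p) v = 0" if "\<And>q. q \<in> \<Omega> \<Longrightarrow> f q $ j = k" for j k v
      using frechet_derivative_transform_within_open[OF cd(1) assms(1) p that] by simp
    have "frechet_derivative (t_comp f) (at p) v = 0" for v
    proof -
      have "contact_form (f p) (frechet_derivative f (at p) v) = 0"
        using contact p by (simp add: contact_map_def)
      then show ?thesis
        using zero[OF x_const, of v] zero[OF y_const, of v] by (simp add: contact_form_def cd(2))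
    qed
    then have "frechet_derivative (t_comp f) (at p) = (\<lambda>v. 0)"
      by (rule ext)
    then show ?thesis
      using has_derivative_partial_deriv[OF cd(1), of 3] by simp
  qed
  then have "t_comp f p = t_comp f x0" if "p \<in> \<Omega>" for p
    using has_derivative_zero_unique_connected[OF assms(1,2) _ that assms(8)] by blast
  then show ?thesis
    using x_const y_const unfolding constant_on_def by blast
qed

end
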